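(* Let $\beta>0$, $M>0$, $G(s)=\exp(-\beta s)$, and let $\varrho$ be a positive stationary solution of $\partial_t\varrho=\frac12\Delta\bigl(G(W\ast\varrho)^2\varrho\bigr)$ on $\mathbb T^d$ with mass $\int_{\mathbb T^d}\varrho\,\mathrm dx=M$. Let $\varrho_0:=M/|\mathbb T^d|$ and let $\lambda\in\mathbb R$ be the constant with $\log\varrho-2\beta\,W\ast\varrho=\lambda$ on $\mathbb T^d$. Then: (1) if $W\in C^k(\mathbb T^d)$, then $\varrho\in C^k(\mathbb T^d)$; (2) if $W\in W^{1,\infty}(\mathbb T^d)$, then $$\|\nabla\log\varrho\|_{L^\infty(\mathbb T^d)}\le2\beta M\,\|\nabla W\|_{L^\infty(\mathbb T^d)};$$ (3) with $\operatorname{osc}_{\mathbb T^d}W:=\max_{\mathbb T^d}W-\min_{\mathbb T^d}W$, $$\frac{\max_{\mathbb T^d}\varrho}{\min_{\mathbb T^d}\varrho}\le\exp\bigl(2\beta M\operatorname{osc}_{\mathbb T^d}W\bigr);$$ (4) $\lambda\le\log\varrho_0-2\beta\varrho_0$, with equality if and only if $\varrho\equiv\varrho_0$.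
   Context: $\mathbb T^d=\mathbb R^d/\mathbb Z^d$. The kernel $W:\mathbb T^d\to[0,\infty)$ is bounded, radially symmetric (in particular even), nonincreasing with respect to $|x|$, obtained by periodic extension of a compactly supported function on $\mathbb R^d$, and normalized by $\int_{\mathbb T^d}W\,\mathrm dx=1$; if its maximum or minimum is not attained, read supremum and infimum in $\operatorname{osc}$. $W\ast\varrho$ is the periodic convolution. A positive stationary solution is a positive density $\varrho$ with $\Delta\bigl(G(W\ast\varrho)^2\varrho\bigr)=0$ on $\mathbb T^d$; equivalently, $\log\varrho-2\beta\,W\ast\varrho$ is equal to a constant $\lambda$, which is the Lagrange multiplier for the mass constraint; equivalently, $\varrho=M e^{2\beta W\ast\varrho}\big/\int_{\mathbb T^d}e^{2\beta W\ast\varrho}\,\mathrm dz$. *)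

theory Defs
  imports "HOL-Analysis.Analysis" "HOL-Probability.Essential_Supremum"
begin

text \<open>
  Functions on the torus \<open>\<real>\<^sup>d / \<int>\<^sup>d\<close> are represented by \<open>\<int>\<^sup>d\<close>-periodic functions on
  \<open>real ^ 'n\<close>, where \<open>d = CARD('n)\<close>.
\<close>

definition int_vecs :: "(real ^ 'n) set" where
  "int_vecs = {k. \<forall>i. k $ i \<in> \<int>}"

definition Zperiodic :: "(real ^ 'n \<Rightarrow> 'b) \<Rightarrow> bool" where
  "Zperiodic f \<longleftrightarrow> (\<forall>x. \<forall>k\<in>int_vecs. f (x + k) = f x)"

text \<open>The opposite faces of the closed unit cube overlap only in a null set.\<close>

definition torus :: "(real ^ 'n) measure" where
  "torus = restrict_space lborel (cbox 0 1)"

text \<open>The length \<open>|x|\<close> of a point of the torus is its distance to \<open>0\<close> in the quotient metric;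
  it is the Euclidean norm on the cell \<open>[-1/2, 1/2]\<^sup>d\<close>.\<close>

definition torus_norm :: "real ^ 'n \<Rightarrow> real" where
  "torus_norm x = infdist x int_vecs"

definition torus_conv :: "(real ^ 'n \<Rightarrow> real) \<Rightarrow> (real ^ 'n \<Rightarrow> real) \<Rightarrow> real ^ 'n \<Rightarrow> real" where
  "torus_conv f g x = (LINT y|torus. f (x - y) * g y)"

definition partial_deriv :: "'n \<Rightarrow> (real ^ 'n \<Rightarrow> real) \<Rightarrow> real ^ 'n \<Rightarrow> real" where
  "partial_deriv i f x = frechet_derivative f (at x) (axis i 1)"

definition laplacian :: "(real ^ 'n \<Rightarrow> real) \<Rightarrow> real ^ 'n \<Rightarrow> real" where
  "laplacian f x = (\<Sum>i\<in>UNIV. partial_deriv i (partial_deriv i f) x)"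

primrec cont_diff :: "nat \<Rightarrow> (real ^ 'n \<Rightarrow> real) \<Rightarrow> bool" where
  "cont_diff 0 f \<longleftrightarrow> continuous_on UNIV f"
| "cont_diff (Suc k) f \<longleftrightarrow>
     (\<forall>x. f differentiable (at x)) \<and> (\<forall>i. cont_diff k (partial_deriv i f))"

definition torus_C :: "nat \<Rightarrow> (real ^ 'n \<Rightarrow> real) set" where
  "torus_C k = {f. Zperiodic f \<and> cont_diff k f}"

definition torus_smooth :: "(real ^ 'n \<Rightarrow> real) set" where
  "torus_smooth = (\<Inter>k. torus_C k)"

definition Linf_norm :: "(real ^ 'n \<Rightarrow> 'b::real_normed_vector) \<Rightarrow> ereal" where
  "Linf_norm f = esssup torus (\<lambda>x. ereal (norm (f x)))"

definition has_weak_gradient :: "(real ^ 'n \<Rightarrow> real) \<Rightarrow> (real ^ 'n \<Rightarrow> real ^ 'n) \<Rightarrow> bool" where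
  "has_weak_gradient f g \<longleftrightarrow>
     Zperiodic f \<and> Zperiodic g \<and> integrable torus f \<and> integrable torus g \<and>
     (\<forall>\<phi>\<in>torus_smooth. \<forall>i.
        (LINT x|torus. f x * partial_deriv i \<phi> x) = - (LINT x|torus. g x $ i * \<phi> x))"

definition torus_W1inf :: "(real ^ 'n \<Rightarrow> real) set" where
  "torus_W1inf =
     {f. Linf_norm f < \<infinity> \<and> (\<exists>g. has_weak_gradient f g \<and> Linf_norm g < \<infinity>)}"

definition weakly_harmonic :: "(real ^ 'n \<Rightarrow> real) \<Rightarrow> bool" where
  "weakly_harmonic f \<longleftrightarrow>
     Zperiodic f \<and> integrable torus f \<and>
     (\<forall>\<phi>\<in>torus_smooth. (LINT x|torus. f x * laplacian \<phi> x) = 0)"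

definition torus_osc :: "(real ^ 'n \<Rightarrow> real) \<Rightarrow> real" where
  "torus_osc f = (SUP x. f x) - (INF x. f x)"

text \<open>The periodic extension of \<open>w\<close> is the lattice sum of its translates. At each point this is a
  finite sum, and if \<open>w\<close> vanishes outside the cell \<open>[-1/2, 1/2)\<^sup>d\<close> it agrees with \<open>w\<close> there.\<close>

definition admissible_kernel :: "(real ^ 'n \<Rightarrow> real) \<Rightarrow> bool" where
  "admissible_kernel W \<longleftrightarrow>
     Zperiodic W \<and> (\<forall>x. 0 \<le> W x) \<and> bounded (range W) \<and>
     (\<forall>x y. torus_norm x = torus_norm y \<longrightarrow> W x = W y) \<and>
     (\<forall>x y. torus_norm x \<le> torus_norm y \<longrightarrow> W y \<le> W x) \<and>
     (\<exists>w. compact (closure {x. w x \<noteq> 0}) \<and>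
          (\<forall>x. W x = (\<Sum>\<^sub>\<infinity>k\<in>int_vecs. w (x + k)))) \<and>
     (LINT x|torus. W x) = 1"

text \<open>The density is an arbitrary integrable function, and the stationary equation
  \<open>\<Delta> (G(W * \<rho>)\<^sup>2 \<rho>) = 0\<close> is read in the sense of distributions.\<close>

definition positive_stationary ::
    "(real \<Rightarrow> real) \<Rightarrow> (real ^ 'n \<Rightarrow> real) \<Rightarrow> (real ^ 'n \<Rightarrow> real) \<Rightarrow> bool" where
  "positive_stationary G W \<rho> \<longleftrightarrow>
     Zperiodic \<rho> \<and> integrable torus \<rho> \<and> (AE x in torus. 0 < \<rho> x) \<and>
     weakly_harmonic (\<lambda>x. (G (torus_conv W \<rho> x))\<^sup>2 * \<rho> x)"

definition is_multiplier ::
    "real \<Rightarrow> (real ^ 'n \<Rightarrow> real) \<Rightarrow> (real ^ 'n \<Rightarrow> real) \<Rightarrow> real \<Rightarrow> bool" where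
  "is_multiplier \<beta> W \<rho> l \<longleftrightarrow>
     (AE x in torus. ln (\<rho> x) - 2 * \<beta> * torus_conv W \<rho> x = l)"

text \<open>A density is determined up to null sets only; a continuous version on the torus is unique.\<close>

definition positive_cont_version :: "(real ^ 'n \<Rightarrow> real) \<Rightarrow> (real ^ 'n \<Rightarrow> real) \<Rightarrow> bool" where
  "positive_cont_version \<rho> r \<longleftrightarrow>
     r \<in> torus_C 0 \<and> (\<forall>x. 0 < r x) \<and> (AE x in torus. \<rho> x = r x)"

end

theory Submission
  imports Defs "HOL-Probability.Probability_Measure"
begin

text \<open>
  A weakly harmonic function on the torus is constant: its Fourier coefficients vanish except for the
  mean, and by the Stone-Weierstrass theorem an integrable function is determined by them. Hence
  \<open>\<rho> = c exp (2 \<beta> (W * \<rho>))\<close> almost everywhere with \<open>ln c = \<lambda>\<close>. A radially monotone bounded kernel is continuous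
  off a null set, so by dominated convergence \<open>W * \<rho>\<close> is continuous, and \<open>r = c exp (2 \<beta> (W * r))\<close> is the
  continuous version. Regularity, the gradient bound and the Harnack-type bound follow by putting
  derivatives and differences on \<open>W\<close>; the bound on \<open>\<lambda>\<close> is Jensen's inequality for \<open>exp\<close> together with
  \<open>\<integral> W * \<rho> = M\<close>.
\<close>

subsection \<open>Integration over the torus\<close>

text \<open>The density is only integrable and W may jump, so nothing pointwise is available at the
  outset. Continuity comes from the kernel alone: a decreasing radial profile has countably many
  jumps, and each of them lives on a level set of the lattice distance, which countably many spheres
  cover. The formula for r is not circular: \<open>u\<close> is computed from \<rho> and r from
  \<open>u\<close>; as convolution ignores null sets, \<open>u\<close> is also the convolution of W
  with r, and from there on only a continuous density occurs. Fourier uniqueness for integrable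
  functions is reached by duality, pairing f with continuous functions that vanish on the boundary
  of the cube; these descend to the product of circles without any matching of faces. The same
  uniqueness makes weak gradients unique, which lets the gradient bound speak of every weak gradient
  of \<open>ln r\<close>. Translation invariance of the integral is the recurring tool: it kills the
  nonconstant trigonometric modes, takes the place of integration by parts, and gives W * r the mean
  M that enters the bound on \<lambda>.\<close>

lemma space_torus: "space torus = cbox 0 1"
  by (simp add: torus_def space_restrict_space)

lemma sets_torus [measurable_cong]: "sets torus = sets (restrict_space borel (cbox 0 1))"
  by (simp add: torus_def sets_restrict_space)

lemma borel_measurable_torus: "f \<in> borel_measurable borel \<Longrightarrow> f \<in> borel_measurable torus"
  by (simp add: torus_def measurable_restrict_space1)

lemma emeasure_torus: "emeasure (torus :: (real ^ 'n) measure) (space torus) = 1"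
proof -
  have "emeasure (torus :: (real ^ 'n) measure) (space torus) = emeasure lborel (cbox 0 (1 :: real ^ 'n))"
    unfolding space_torus torus_def by (subst emeasure_restrict_space) auto
  also have "\<dots> = 1"
    by (subst emeasure_lborel_cbox) (auto simp: Basis_vec_def inner_axis intro!: prod.neutral)
  finally show ?thesis .
qed

lemma prob_space_torus: "prob_space torus"
  by (rule prob_spaceI) (rule emeasure_torus)

text \<open>The torus has total mass 1, so it is not a null set. Facts about constants, such as the
  sign of \<open>c\<close> or the value of the multiplier, are extracted from almost-everywhere
  statements in this way.\<close>

lemma AE_torus_const: "(AE x in (torus :: (real ^ 'n) measure). P) \<longleftrightarrow> P"
proof -
  interpret prob_space "torus :: (real ^ 'n) measure" by (rule prob_space_torus)
  show ?thesis by simp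
qed

lemma AE_torus_iff: "(AE x in torus. P x) \<longleftrightarrow> (AE x in lborel. x \<in> cbox 0 1 \<longrightarrow> P x)"
  unfolding torus_def by (rule AE_restrict_space_iff) auto

lemma integral_torus:
  fixes f :: "real ^ 'n \<Rightarrow> 'b::{banach, second_countable_topology}"
  shows "(LINT x|torus. f x) = (LINT x:cbox 0 1|lborel. f x)"
  unfolding torus_def set_lebesgue_integral_def by (rule integral_restrict_space) auto

text \<open>Spheres, frontiers and exceptional sets of measurable functions come as
  \<open>negligible\<close>, a notion of the completed measure; the set need not be Borel, so the
  transfer to \<open>lborel\<close> goes through the completion.\<close>

lemma AE_torusI_negligible:
  assumes "negligible N" "\<And>x. x \<in> cbox 0 1 \<Longrightarrow> x \<notin> N \<Longrightarrow> P x"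
  shows "AE x in torus. P x"
proof -
  have "AE x in lebesgue. x \<notin> N"
    using assms(1) by (simp add: negligible_iff_null_sets AE_not_in)
  then have "AE x in lborel. x \<notin> N"
    by (simp add: AE_completion_iff)
  then show ?thesis
    unfolding AE_torus_iff by (rule eventually_mono) (use assms(2) in auto)
qed

lemma integrable_torus_bounded:
  fixes f :: "real ^ 'n \<Rightarrow> 'b::{banach, second_countable_topology}"
  assumes "f \<in> borel_measurable torus" "AE x in torus. norm (f x) \<le> B"
  shows "integrable torus f"
proof -
  interpret prob_space "torus :: (real ^ 'n) measure" by (rule prob_space_torus)
  show ?thesis by (rule integrable_const_bound[OF assms(2,1)])
qed

lemma integrable_torus_continuous:
  fixes f :: "real ^ 'n \<Rightarrow> real"
  assumes "continuous_on UNIV f"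
  shows "integrable torus f"
proof -
  have "bounded (f ` cbox 0 1)"
    by (intro compact_imp_bounded compact_continuous_image continuous_on_subset[OF assms]) auto
  then obtain B where "\<And>x. x \<in> cbox 0 1 \<Longrightarrow> norm (f x) \<le> B"
    by (auto simp: bounded_iff)
  then show ?thesis
    by (intro integrable_torus_bounded borel_measurable_torus borel_measurable_continuous_onI assms
          AE_I2) (auto simp: space_torus)
qed

text \<open>Bridge to the gauge integral, in which \<open>has_integral_0_cbox_imp_0\<close> and
  \<open>leibniz_rule\<close> are stated.\<close>

lemma has_integral_torus_continuous:
  fixes f :: "real ^ 'n \<Rightarrow> real"
  assumes "continuous_on (cbox 0 1) f"
  shows "(f has_integral (LINT x|torus. f x)) (cbox 0 1)"
proof -
  have "set_integrable lborel (cbox 0 1) f"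
    unfolding set_integrable_def by (rule borel_integrable_compact) (use assms in auto)
  then show ?thesis
    unfolding integral_torus set_borel_integral_eq_integral(2)[OF \<open>set_integrable lborel (cbox 0 1) f\<close>]
    by (intro integrable_integral set_borel_integral_eq_integral(1))
qed

subsection \<open>Periodic functions\<close>

text \<open>An exact fundamental domain: each point has one integer translate in it, whereas the
  closed cube contains both copies of every face. The unfolding argument needs this
  exactness.\<close>

definition half_open_cube :: "(real ^ 'n) set" where
  "half_open_cube = {x. \<forall>i. 0 \<le> x $ i \<and> x $ i < 1}"

definition floor_vec :: "real ^ 'n \<Rightarrow> real ^ 'n" where
  "floor_vec x = (\<chi> i. real_of_int \<lfloor>x $ i\<rfloor>)"

lemma floor_vec_in [simp]: "floor_vec x \<in> int_vecs"
  by (simp add: floor_vec_def int_vecs_def)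

lemma int_vecs_simps [simp]:
  "0 \<in> int_vecs" "k \<in> int_vecs \<Longrightarrow> - k \<in> int_vecs"
  "k \<in> int_vecs \<Longrightarrow> l \<in> int_vecs \<Longrightarrow> k + l \<in> int_vecs"
  "k \<in> int_vecs \<Longrightarrow> l \<in> int_vecs \<Longrightarrow> k - l \<in> int_vecs"
  "axis i 1 \<in> int_vecs"
  by (auto simp: int_vecs_def axis_def)

lemma countable_int_vecs: "countable (int_vecs :: (real ^ 'n) set)"
proof -
  have "(int_vecs :: (real ^ 'n) set) \<subseteq> vec_lambda ` (UNIV \<rightarrow>\<^sub>E \<int>)"
  proof
    fix k :: "real ^ 'n" assume "k \<in> int_vecs"
    then have "vec_nth k \<in> UNIV \<rightarrow>\<^sub>E \<int>" by (auto simp: int_vecs_def)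
    then show "k \<in> vec_lambda ` (UNIV \<rightarrow>\<^sub>E \<int>)" by (metis image_eqI vec_nth_inverse)
  qed
  moreover have "countable (UNIV \<rightarrow>\<^sub>E \<int> :: ('n \<Rightarrow> real) set)"
    by (rule countable_PiE) (auto simp: Ints_def)
  ultimately show ?thesis by (meson countable_image countable_subset)
qed

lemma diff_floor_vec_in: "x - floor_vec x \<in> half_open_cube"
  by (auto simp: floor_vec_def half_open_cube_def) linarith+

lemma diff_int_vec_in_iff:
  assumes "k \<in> int_vecs"
  shows "x - k \<in> half_open_cube \<longleftrightarrow> k = floor_vec x"
proof
  assume *: "x - k \<in> half_open_cube"
  show "k = floor_vec x"
  proof (rule vec_eq_iff[THEN iffD2], rule allI)
    fix i
    obtain m where m: "k $ i = of_int m" using assms by (auto simp: int_vecs_def Ints_def)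
    moreover have "0 \<le> x $ i - k $ i" "x $ i - k $ i < 1" using * by (auto simp: half_open_cube_def)
    ultimately have "\<lfloor>x $ i\<rfloor> = m" by (simp add: floor_eq_iff)
    then show "k $ i = floor_vec x $ i" using m by (simp add: floor_vec_def)
  qed
qed (simp add: diff_floor_vec_in)

lemma half_open_cube_subset: "half_open_cube \<subseteq> cbox 0 1"
  by (auto simp: half_open_cube_def mem_box_cart less_imp_le)

lemma box_subset_half_open_cube: "box 0 1 \<subseteq> half_open_cube"
  by (auto simp: half_open_cube_def mem_box_cart less_imp_le)

lemma half_open_cube_sets [measurable]: "half_open_cube \<in> sets borel"
  unfolding half_open_cube_def by measurable

lemma ZperiodicD: "Zperiodic f \<Longrightarrow> k \<in> int_vecs \<Longrightarrow> f (x + k) = f x"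
  by (simp add: Zperiodic_def)

lemma ZperiodicD': "Zperiodic f \<Longrightarrow> k \<in> int_vecs \<Longrightarrow> f (x - k) = f x"
  using ZperiodicD[of f "- k" x] by simp

lemma Zperiodic_diff_floor_vec: "Zperiodic f \<Longrightarrow> f (x - floor_vec x) = f x"
  by (simp add: ZperiodicD')

lemma Zperiodic_ball_cube:
  assumes "Zperiodic f" "\<And>x. x \<in> cbox 0 1 \<Longrightarrow> P (f x)"
  shows "P (f x)"
  using assms(2)[of "x - floor_vec x"] half_open_cube_subset diff_floor_vec_in[of x]
    Zperiodic_diff_floor_vec[OF assms(1), of x] by auto

lemma Zperiodic_shift: "Zperiodic f \<Longrightarrow> Zperiodic (\<lambda>x. f (x + y))"
  unfolding Zperiodic_def by (metis add.assoc add.commute)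

lemma bounded_Zperiodic_continuous:
  fixes f :: "real ^ 'n \<Rightarrow> real"
  assumes "Zperiodic f" "continuous_on UNIV f"
  obtains B where "\<And>x. \<bar>f x\<bar> \<le> B"
proof -
  have "bounded (f ` cbox 0 1)"
    by (intro compact_imp_bounded compact_continuous_image continuous_on_subset[OF assms(2)]) auto
  then obtain B where "\<And>x. x \<in> cbox 0 1 \<Longrightarrow> norm (f x) \<le> B"
    by (auto simp: bounded_iff)
  then have "\<bar>f x\<bar> \<le> B" for x
    using Zperiodic_ball_cube[OF assms(1), of "\<lambda>y. \<bar>y\<bar> \<le> B"] by simp
  then show ?thesis by (rule that)
qed

text \<open>The square of f - c is continuous and nonnegative with integral 0, hence vanishes on the
  cube; periodicity does the rest.\<close>

lemma Zperiodic_continuous_AE_imp_eq: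
  fixes f :: "real ^ 'n \<Rightarrow> real"
  assumes "Zperiodic f" "continuous_on UNIV f" "AE x in torus. f x = c"
  shows "f x = c"
proof -
  have c: "continuous_on (cbox 0 1) (\<lambda>x. (f x - c)\<^sup>2)"
    by (intro continuous_intros continuous_on_subset[OF assms(2)]) auto
  have "(LINT x|torus. (f x - c)\<^sup>2) = (LINT x|(torus :: (real ^ 'n) measure). 0)"
    using assms(3) by (intro integral_cong_AE borel_measurable_torus borel_measurable_continuous_onI
       continuous_intros assms(2)) auto
  then have "((\<lambda>x. (f x - c)\<^sup>2) has_integral 0) (cbox 0 1)"
    using has_integral_torus_continuous[OF c] by simp
  then have "(f x - c)\<^sup>2 = 0" if "x \<in> cbox 0 1" for x
    by (rule has_integral_0_cbox_imp_0[OF c, rotated]) (use that in \<open>auto simp: interval_ne_empty_cart\<close>)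
  then show ?thesis using Zperiodic_ball_cube[OF assms(1), of "\<lambda>y. y = c"] by simp
qed

text \<open>Integrability over \<open>torus\<close> only yields measurability on the cube, while
  convolutions evaluate at \<open>x - y\<close>. Reducing the argument modulo the lattice by the
  Borel map \<open>x - floor_vec x\<close> closes the gap.\<close>

lemma Zperiodic_borel_measurable:
  fixes f :: "real ^ 'n \<Rightarrow> 'b::topological_space"
  assumes "Zperiodic f" "f \<in> borel_measurable torus"
  shows "f \<in> borel_measurable borel"
proof -
  have "(\<lambda>x :: real ^ 'n. x - floor_vec x) \<in> borel \<rightarrow>\<^sub>M borel"
    by (subst borel_measurable_euclidean_space)
       (auto simp: Basis_vec_def inner_axis floor_vec_def)
  then have "(\<lambda>x :: real ^ 'n. x - floor_vec x) \<in> borel \<rightarrow>\<^sub>M torus"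
    by (subst measurable_cong_sets[OF refl sets_torus], intro measurable_restrict_space2)
       (use half_open_cube_subset diff_floor_vec_in in auto)
  from measurable_compose[OF this assms(2)] show ?thesis
    by (simp add: Zperiodic_diff_floor_vec[OF assms(1)])
qed

section \<open>Translation invariance of the integral of periodic functions\<close>

lemma nn_integral_lborel_shift:
  fixes f :: "'a::euclidean_space \<Rightarrow> ennreal"
  assumes [measurable]: "f \<in> borel_measurable borel"
  shows "(\<integral>\<^sup>+x. f (x + c) \<partial>lborel) = (\<integral>\<^sup>+x. f x \<partial>lborel)"
proof -
  have "(\<integral>\<^sup>+x. f x \<partial>distr lborel borel ((+) c)) = (\<integral>\<^sup>+x. f (c + x) \<partial>lborel)"
    by (rule nn_integral_distr) auto
  then show ?thesis by (simp add: lborel_distr_plus add.commute)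
qed

lemma nn_integral_torus:
  fixes f :: "real ^ 'n \<Rightarrow> ennreal"
  shows "(\<integral>\<^sup>+x. f x \<partial>torus) = (\<integral>\<^sup>+x. f x * indicator half_open_cube x \<partial>lborel)"
proof -
  have "AE x :: real ^ 'n in lborel. x \<notin> cbox 0 1 - box 0 1"
  proof -
    have "AE x :: real ^ 'n in lebesgue. x \<notin> cbox 0 1 - box 0 1"
      using negligible_frontier_interval[of 0 "1 :: real ^ 'n"]
      unfolding negligible_iff_null_sets by (rule AE_not_in)
    then show ?thesis unfolding AE_completion_iff .
  qed
  then have "AE x in lborel. f x * indicator (cbox 0 1) x = f x * indicator half_open_cube x"
    by (rule eventually_mono)
       (use half_open_cube_subset box_subset_half_open_cube in \<open>auto simp: indicator_def\<close>)
  then show ?thesis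
    unfolding torus_def by (simp add: nn_integral_restrict_space nn_integral_cong_AE)
qed

text \<open>The lattice translates of the half-open cube tile space, so only
  \<open>k = floor_vec x\<close> contributes. Inserted as a factor 1, this sum cuts any other domain
  into pieces.\<close>

lemma nn_integral_floor_vec_indicator:
  "(\<integral>\<^sup>+k. indicator half_open_cube (x - k) \<partial>count_space int_vecs) = (1 :: ennreal)"
proof -
  have "(\<integral>\<^sup>+k. indicator half_open_cube (x - k) \<partial>count_space int_vecs)
      = (\<integral>\<^sup>+k. indicator {floor_vec x} k \<partial>count_space int_vecs)"
    by (rule nn_integral_cong) (auto simp: indicator_def diff_int_vec_in_iff)
  also have "\<dots> = 1"
    by (subst nn_integral_indicator) auto
  finally show ?thesis .
qed

text \<open>Both the unit cube and its translate by \<open>y\<close> are fundamental domains of \<open>\<int>\<^sup>d\<close>: cut one along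
  the lattice translates of the other and move the pieces.\<close>

lemma nn_integral_torus_shift:
  fixes f :: "real ^ 'n \<Rightarrow> ennreal"
  assumes f[measurable]: "f \<in> borel_measurable borel" and per: "Zperiodic f"
  shows "(\<integral>\<^sup>+x. f (x + y) \<partial>torus) = (\<integral>\<^sup>+x. f x \<partial>torus)"
proof -
  let ?Q = "indicator half_open_cube :: real ^ 'n \<Rightarrow> ennreal"
  have "(\<integral>\<^sup>+x. f (x + y) \<partial>torus) = (\<integral>\<^sup>+x. f (x + y) * ?Q (x + y - y) \<partial>lborel)"
    by (simp add: nn_integral_torus)
  also have "\<dots> = (\<integral>\<^sup>+x. f x * ?Q (x - y) \<partial>lborel)"
    by (rule nn_integral_lborel_shift) measurable
  also have "\<dots> = (\<integral>\<^sup>+x. (\<integral>\<^sup>+k. f x * ?Q (x - y) * ?Q (x - k) \<partial>count_space int_vecs) \<partial>lborel)"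
    by (simp add: nn_integral_cmult nn_integral_floor_vec_indicator)
  also have "\<dots> = (\<integral>\<^sup>+k. (\<integral>\<^sup>+x. f x * ?Q (x - y) * ?Q (x - k) \<partial>lborel) \<partial>count_space int_vecs)"
    by (rule nn_integral_count_space_nn_integral[OF countable_int_vecs]) measurable
  also have "\<dots> = (\<integral>\<^sup>+k. (\<integral>\<^sup>+x. f (x + k) * ?Q (x + k - y) * ?Q (x + k - k) \<partial>lborel) \<partial>count_space int_vecs)"
    by (intro nn_integral_cong nn_integral_lborel_shift[symmetric]) measurable
  also have "\<dots> = (\<integral>\<^sup>+k. (\<integral>\<^sup>+x. f x * ?Q x * ?Q (x - y + k) \<partial>lborel) \<partial>count_space int_vecs)"
    by (intro nn_integral_cong) (simp add: ZperiodicD[OF per] diff_add_eq mult_ac)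
  also have "\<dots> = (\<integral>\<^sup>+x. (\<integral>\<^sup>+k. f x * ?Q x * ?Q (x - y + k) \<partial>count_space int_vecs) \<partial>lborel)"
    by (rule nn_integral_count_space_nn_integral[OF countable_int_vecs, symmetric]) measurable
  also have "\<dots> = (\<integral>\<^sup>+x. f x * ?Q x \<partial>lborel)"
  proof (rule nn_integral_cong)
    fix x
    have b: "bij_betw uminus int_vecs (int_vecs :: (real ^ 'n) set)"
      by (rule bij_betw_byWitness[where f' = uminus]) auto
    have "(\<integral>\<^sup>+k. ?Q (x - y + k) \<partial>count_space int_vecs) = (\<integral>\<^sup>+k. ?Q (x - y - k) \<partial>count_space int_vecs)"
      using nn_integral_bij_count_space[OF b, of "\<lambda>k. ?Q (x - y + k)"] by simp
    then show "(\<integral>\<^sup>+k. f x * ?Q x * ?Q (x - y + k) \<partial>count_space int_vecs) = f x * ?Q x"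
      by (simp add: nn_integral_cmult nn_integral_floor_vec_indicator)
  qed
  finally show ?thesis by (simp add: nn_integral_torus)
qed

lemma integrable_torus_shift:
  fixes f :: "real ^ 'n \<Rightarrow> real"
  assumes [measurable]: "f \<in> borel_measurable borel" and per: "Zperiodic f" and i: "integrable torus f"
  shows "integrable torus (\<lambda>x. f (x + y))"
proof -
  have "(\<integral>\<^sup>+x. ennreal (norm (f (x + y))) \<partial>torus) = (\<integral>\<^sup>+x. ennreal (norm (f x)) \<partial>torus)"
    by (rule nn_integral_torus_shift) (use per in \<open>auto simp: Zperiodic_def\<close>)
  moreover have "(\<lambda>x. f (x + y)) \<in> borel_measurable torus"
    by (rule borel_measurable_torus) measurable
  ultimately show ?thesis using i by (simp add: integrable_iff_bounded)
qed

lemma integral_torus_shift: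
  fixes f :: "real ^ 'n \<Rightarrow> real"
  assumes [measurable]: "f \<in> borel_measurable borel" and per: "Zperiodic f" and i: "integrable torus f"
  shows "(LINT x|torus. f (x + y)) = (LINT x|torus. f x)"
proof -
  have "(\<integral>\<^sup>+x. ennreal (f (x + y)) \<partial>torus) = (\<integral>\<^sup>+x. ennreal (f x) \<partial>torus)"
    "(\<integral>\<^sup>+x. ennreal (- f (x + y)) \<partial>torus) = (\<integral>\<^sup>+x. ennreal (- f x) \<partial>torus)"
    by (rule nn_integral_torus_shift; use per in \<open>auto simp: Zperiodic_def\<close>)+
  then show ?thesis
    by (simp add: real_lebesgue_integral_def i integrable_torus_shift[OF assms])
qed

subsection \<open>Differentiability classes\<close>

lemma partial_deriv_eq:
  "(f has_derivative f') (at x) \<Longrightarrow> partial_deriv i f x = f' (axis i 1)"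
  unfolding partial_deriv_def by (metis frechet_derivative_at)

lemma has_derivative_shift_iff:
  fixes f :: "'a::real_normed_vector \<Rightarrow> 'b::real_normed_vector"
  shows "((\<lambda>z. f (z + y)) has_derivative f') (at x) \<longleftrightarrow> (f has_derivative f') (at (x + y))"
proof
  assume "((\<lambda>z. f (z + y)) has_derivative f') (at x)"
  then have "((\<lambda>z. f (z - y + y)) has_derivative f') (at (x + y))"
    by (intro has_derivative_compose[where f = "\<lambda>z. z - y" and g = "\<lambda>z. f (z + y)" and f' = "\<lambda>h. h"])
       (auto intro!: derivative_eq_intros)
  then show "(f has_derivative f') (at (x + y))" by simp
next
  assume "(f has_derivative f') (at (x + y))"
  then show "((\<lambda>z. f (z + y)) has_derivative f') (at x)"
    by (intro has_derivative_compose[where f = "\<lambda>z. z + y" and g = f and f' = "\<lambda>h. h"])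
       (auto intro!: derivative_eq_intros)
qed

text \<open>Valid even where no derivative exists: both sides choose from the same set of
  derivatives, so the choice operator returns the same value.\<close>

lemma partial_deriv_shift: "partial_deriv i (\<lambda>z. f (z + y)) x = partial_deriv i f (x + y)"
  by (simp add: partial_deriv_def frechet_derivative_def has_derivative_shift_iff)

lemma Zperiodic_partial_deriv:
  assumes "Zperiodic f"
  shows "Zperiodic (partial_deriv i f)"
  unfolding Zperiodic_def
proof (intro allI ballI)
  fix x k :: "real ^ 'a" assume "k \<in> int_vecs"
  then have "(\<lambda>z. f (z + k)) = f" using assms by (simp add: Zperiodic_def)
  then show "partial_deriv i f (x + k) = partial_deriv i f x"
    using partial_deriv_shift[of i f k x] by simp
qed

lemma cont_diff_imp_continuous: "cont_diff k f \<Longrightarrow> continuous_on UNIV f"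
  by (cases k) (auto intro!: differentiable_imp_continuous_on simp: differentiable_on_def)

lemma cont_diff_SucD: "cont_diff (Suc k) f \<Longrightarrow> cont_diff k f"
proof (induction k arbitrary: f)
  case 0
  then show ?case using cont_diff_imp_continuous[of "Suc 0" f] by simp
qed auto

lemma cont_diff_const [simp]: "cont_diff k (\<lambda>_. c)"
proof (induction k arbitrary: c)
  case (Suc k)
  have "partial_deriv i (\<lambda>_ :: real ^ 'a. c) = (\<lambda>_. 0)" for i
    by (rule ext, subst partial_deriv_eq[OF has_derivative_const]) simp
  then show ?case using Suc by simp
qed simp

lemma cont_diff_add:
  "cont_diff k f \<Longrightarrow> cont_diff k g \<Longrightarrow> cont_diff k (\<lambda>x. f x + g x)"
proof (induction k arbitrary: f g)
  case (Suc k)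
  have d: "(h has_derivative frechet_derivative h (at x)) (at x)" if "h = f \<or> h = g" for h x
    using Suc.prems that by (auto intro: frechet_derivative_works[THEN iffD1])
  have "partial_deriv i (\<lambda>x. f x + g x) = (\<lambda>x. partial_deriv i f x + partial_deriv i g x)" for i
    by (rule ext, subst partial_deriv_eq[OF has_derivative_add[OF d d]])
       (auto simp: partial_deriv_def)
  then show ?case using Suc by auto
qed (simp add: continuous_on_add)

lemma cont_diff_mult:
  "cont_diff k f \<Longrightarrow> cont_diff k g \<Longrightarrow> cont_diff k (\<lambda>x. f x * g x)"
proof (induction k arbitrary: f g)
  case (Suc k)
  have d: "(h has_derivative frechet_derivative h (at x)) (at x)" if "h = f \<or> h = g" for h x
    using Suc.prems that by (auto intro: frechet_derivative_works[THEN iffD1])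
  have "partial_deriv i (\<lambda>x. f x * g x) = (\<lambda>x. f x * partial_deriv i g x + partial_deriv i f x * g x)" for i
    by (rule ext, subst partial_deriv_eq[OF has_derivative_mult[OF d d]])
       (auto simp: partial_deriv_def)
  then show ?case
    using Suc.prems cont_diff_SucD[OF Suc.prems(1)] cont_diff_SucD[OF Suc.prems(2)]
    by (auto intro!: cont_diff_add Suc.IH differentiable_mult)
qed (simp add: continuous_on_mult)

text \<open>The derivative contains \<open>exp (f x)\<close> again, but only to order k, so the
  induction hypothesis applies after \<open>cont_diff_SucD\<close> lowers the order of f.\<close>

lemma cont_diff_exp: "cont_diff k f \<Longrightarrow> cont_diff k (\<lambda>x. exp (f x))"
proof (induction k)
  case (Suc k)
  have d: "((\<lambda>x. exp (f x)) has_derivative (\<lambda>h. exp (f x) * frechet_derivative f (at x) h)) (at x)" for x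
    using Suc.prems frechet_derivative_works by (auto intro!: derivative_eq_intros)
  have "partial_deriv i (\<lambda>x. exp (f x)) = (\<lambda>x. exp (f x) * partial_deriv i f x)" for i
    by (rule ext, subst partial_deriv_eq[OF d]) (auto simp: partial_deriv_def)
  then show ?case
    using Suc.prems d cont_diff_SucD[OF Suc.prems(1)] Suc.IH
    by (auto intro!: cont_diff_mult simp: differentiable_def)
qed (simp add: continuous_on_exp)

lemma cont_diff_shift: "cont_diff k f \<Longrightarrow> cont_diff k (\<lambda>z. f (z + y))"
proof (induction k arbitrary: f)
  case 0
  have "continuous_on UNIV (\<lambda>z. z + y)" by (intro continuous_intros)
  then show ?case using 0 continuous_on_compose2[of UNIV f UNIV "\<lambda>z. z + y"] by simp
next
  case (Suc k)
  have "partial_deriv i (\<lambda>z. f (z + y)) = (\<lambda>z. partial_deriv i f (z + y))" for i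
    using partial_deriv_shift by blast
  then show ?case using Suc by (auto simp: differentiable_def has_derivative_shift_iff)
qed

lemma torus_smooth_shift: "\<phi> \<in> torus_smooth \<Longrightarrow> (\<lambda>z. \<phi> (z + y)) \<in> torus_smooth"
  by (auto simp: torus_smooth_def torus_C_def intro: cont_diff_shift Zperiodic_shift)

lemma torus_smoothD:
  assumes "\<phi> \<in> torus_smooth"
  shows "Zperiodic \<phi>" "cont_diff k \<phi>"
  using assms by (auto simp: torus_smooth_def torus_C_def)

subsection \<open>Trigonometric polynomials\<close>

text \<open>A real Fourier mode of frequency k. Keeping both coefficients free makes the family
  closed under partial derivatives, which send (a, b) to 2 pi k_i (b, -a).\<close>

definition trig_monomial :: "real \<Rightarrow> real \<Rightarrow> real ^ 'n \<Rightarrow> real ^ 'n \<Rightarrow> real" where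
  "trig_monomial a b k x = a * cos (2 * pi * (k \<bullet> x)) + b * sin (2 * pi * (k \<bullet> x))"

lemma has_derivative_trig_monomial:
  "(trig_monomial a b k has_derivative
     (\<lambda>h. trig_monomial (2 * pi * b) (- (2 * pi * a)) k x * (k \<bullet> h))) (at x)"
  unfolding trig_monomial_def
  by (auto intro!: derivative_eq_intros ext simp: algebra_simps)

lemma partial_deriv_trig_monomial:
  "partial_deriv i (trig_monomial a b k) =
     trig_monomial (2 * pi * (k $ i) * b) (- (2 * pi * (k $ i) * a)) k"
  by (rule ext, subst partial_deriv_eq[OF has_derivative_trig_monomial])
     (simp add: trig_monomial_def inner_axis algebra_simps)

lemma cont_diff_trig_monomial: "cont_diff n (trig_monomial a b k)"
proof (induction n arbitrary: a b)
  case 0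
  show ?case unfolding trig_monomial_def cont_diff.simps by (intro continuous_intros)
next
  case (Suc n)
  then show ?case
    by (simp add: partial_deriv_trig_monomial has_derivative_trig_monomial[THEN differentiableI])
qed

lemma laplacian_trig_monomial:
  "laplacian (trig_monomial a b k) x = - (4 * pi\<^sup>2 * (norm k)\<^sup>2) * trig_monomial a b k x"
proof -
  have "(norm k)\<^sup>2 = (\<Sum>i\<in>UNIV. (k $ i)\<^sup>2)"
    unfolding power2_norm_eq_inner inner_vec_def by (simp add: power2_eq_square)
  then have "- (4 * pi\<^sup>2 * (norm k)\<^sup>2) * trig_monomial a b k x
      = (\<Sum>i\<in>UNIV. - (4 * pi\<^sup>2 * (k $ i)\<^sup>2) * trig_monomial a b k x)"
    by (simp add: sum_distrib_left sum_distrib_right sum_negf)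
  moreover have "partial_deriv i (partial_deriv i (trig_monomial a b k)) x
      = - (4 * pi\<^sup>2 * (k $ i)\<^sup>2) * trig_monomial a b k x" for i
    by (simp add: partial_deriv_trig_monomial trig_monomial_def power2_eq_square algebra_simps)
  ultimately show ?thesis by (simp only: laplacian_def)
qed

lemma inner_int_vecs: "k \<in> int_vecs \<Longrightarrow> l \<in> int_vecs \<Longrightarrow> k \<bullet> l \<in> \<int>"
  by (auto simp: int_vecs_def inner_vec_def intro!: Ints_sum Ints_mult)

lemma trig_monomial_smooth:
  assumes "k \<in> int_vecs"
  shows "trig_monomial a b k \<in> torus_smooth"
proof -
  have "trig_monomial a b k (x + l) = trig_monomial a b k x" if "l \<in> int_vecs" for x l
  proof -
    obtain m where "k \<bullet> l = of_int m" using inner_int_vecs[OF assms \<open>l \<in> int_vecs\<close>] by (auto simp: Ints_def)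
    then have "2 * pi * (k \<bullet> (x + l)) = 2 * pi * (k \<bullet> x) + 2 * pi * of_int m"
      by (simp add: inner_add_right algebra_simps)
    then show ?thesis by (simp add: trig_monomial_def cos_add sin_add)
  qed
  then show ?thesis
    by (auto simp: torus_smooth_def torus_C_def cont_diff_trig_monomial Zperiodic_def)
qed

text \<open>Products are no generators, so an induction that proves a linear fact, such as the
  vanishing of integrals against f, has only two easy cases. Scalars are absorbed into a and
  b.\<close>

inductive trig_polynomial :: "(real ^ 'n \<Rightarrow> real) \<Rightarrow> bool" where
  monomial: "k \<in> int_vecs \<Longrightarrow> trig_polynomial (trig_monomial a b k)"
| add: "trig_polynomial f \<Longrightarrow> trig_polynomial g \<Longrightarrow> trig_polynomial (\<lambda>x. f x + g x)"

lemma trig_monomial_mult: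
  "trig_monomial a b k x * trig_monomial c d l x =
     trig_monomial ((a * c - b * d) / 2) ((a * d + b * c) / 2) (k + l) x +
     trig_monomial ((a * c + b * d) / 2) ((b * c - a * d) / 2) (k - l) x"
proof -
  \<comment> \<open>Here p, q are the cosine and sine belonging to k, and r, s those belonging to l.
    The brackets \<open>p * r - q * s\<close> and \<open>q * r + p * s\<close> are cosine and sine
    for k + l; the other two brackets are those for k - l.\<close>
  have "(a * p + b * q) * (c * r + d * s) =
      ((a * c - b * d) / 2 * (p * r - q * s) + (a * d + b * c) / 2 * (q * r + p * s)) +
      ((a * c + b * d) / 2 * (p * r + q * s) + (b * c - a * d) / 2 * (q * r - p * s))" for p q r s
    by (simp add: algebra_simps add_divide_distrib diff_divide_distrib)
  then show ?thesis
    unfolding trig_monomial_def inner_add_left inner_diff_left distrib_left right_diff_distrib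
      cos_add sin_add cos_diff sin_diff by blast
qed

lemma trig_polynomial_const: "trig_polynomial (\<lambda>_. c)"
  using trig_polynomial.monomial[of 0 c 0] by (simp add: trig_monomial_def[abs_def])

lemma trig_polynomial_sum:
  "finite I \<Longrightarrow> (\<And>i. i \<in> I \<Longrightarrow> trig_polynomial (f i)) \<Longrightarrow> trig_polynomial (\<lambda>x. \<Sum>i\<in>I. f i x)"
  by (induction I rule: finite_induct) (auto intro: trig_polynomial.add trig_polynomial_const)

lemma trig_polynomial_mult:
  assumes "trig_polynomial f" "trig_polynomial g"
  shows "trig_polynomial (\<lambda>x. f x * g x)"
  using assms
proof (induction arbitrary: g)
  case (monomial k a b)
  from monomial(2) show ?case
  proof induction
    case (monomial l c d)
    then show ?case
      unfolding trig_monomial_mult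
      using \<open>k \<in> int_vecs\<close> by (intro trig_polynomial.intros) auto
  next
    case (add f' g')
    then show ?case unfolding distrib_left by (intro trig_polynomial.add)
  qed
next
  case (add f f')
  then show ?case unfolding distrib_right by (intro trig_polynomial.add) auto
qed

text \<open>The embedding of the torus as a product of circles; on its compact image trigonometric
  polynomials become ordinary polynomials, to which the Stone-Weierstrass theorem applies.\<close>

definition circles :: "real ^ 'n \<Rightarrow> (real ^ 'n) \<times> (real ^ 'n)" where
  "circles x = ((\<chi> i. cos (2 * pi * (x $ i))), (\<chi> i. sin (2 * pi * (x $ i))))"

lemma continuous_on_circles: "continuous_on S circles"
  unfolding circles_def by (intro continuous_intros)

text \<open>Equal images force integer coordinate differences. If one of the two points is interior,
  each difference lies strictly between -1 and 1 and is 0. Hence only boundary points are glued, and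
  there the approximated function vanishes.\<close>

lemma circles_eq:
  assumes "x \<in> cbox 0 1" "y \<in> cbox 0 1" "circles x = circles y"
  shows "x = y \<or> x \<notin> box 0 1 \<and> y \<notin> box 0 1"
proof (rule disjCI)
  assume *: "\<not> (x \<notin> box 0 1 \<and> y \<notin> box 0 1)"
  show "x = y"
  proof (rule vec_eq_iff[THEN iffD2], rule allI)
    fix i
    have "cos (2 * pi * (x $ i)) = cos (2 * pi * (y $ i))" "sin (2 * pi * (x $ i)) = sin (2 * pi * (y $ i))"
      using assms(3) by (auto simp: circles_def vec_eq_iff)
    then obtain m where "2 * pi * (x $ i) = 2 * pi * (y $ i) + 2 * pi * of_int m"
      using sin_cos_eq_iff by blast
    then have m: "x $ i = y $ i + of_int m" by (simp flip: distrib_left)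
    have "x $ i \<in> {0..1}" "y $ i \<in> {0..1}" "x $ i \<in> {0<..<1} \<or> y $ i \<in> {0<..<1}"
      using assms(1,2) * by (auto simp: mem_box_cart)
    then have "- 1 < real_of_int m" "real_of_int m < 1" using m by auto
    then have "m = 0" by linarith
    then show "x $ i = y $ i" using m by simp
  qed
qed

lemma trig_polynomial_circles:
  fixes p :: "(real ^ 'n) \<times> (real ^ 'n) \<Rightarrow> real"
  assumes "real_polynomial_function p"
  shows "trig_polynomial (\<lambda>x. p (circles x))"
  using assms
proof induction
  case (linear p)
  interpret bounded_linear p by fact
  \<comment> \<open>A linear form is determined by its values on the unit vectors; these become the
    cosine and sine coefficients of the modes of frequency \<open>axis i 1\<close>.\<close>
  have "p (circles x) = (\<Sum>i\<in>UNIV. trig_monomial (p (axis i 1, 0)) (p (0, axis i 1)) (axis i 1) x)" for x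
  proof -
    have "circles x = (\<Sum>i\<in>UNIV. cos (2 * pi * (x $ i)) *\<^sub>R (axis i 1, 0) + sin (2 * pi * (x $ i)) *\<^sub>R (0, axis i 1))"
      by (simp add: circles_def prod_eq_iff fst_sum snd_sum vec_eq_iff axis_def if_distrib cong: if_cong)
    then show ?thesis
      by (simp only: sum add scaleR trig_monomial_def inner_axis' inner_real_def real_scaleR_def mult.commute mult_1)
  qed
  then show ?case by (simp only:) (intro trig_polynomial_sum trig_polynomial.monomial; simp)
next
  case (const c)
  show ?case by (rule trig_polynomial_const)
next
  case (add f g)
  then show ?case by (intro trig_polynomial.add)
next
  case (mult f g)
  then show ?case by (intro trig_polynomial_mult)
qed

text \<open>Vanishing on the boundary makes \<phi> constant on the fibres of \<open>circles\<close>,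
  so it factors through the compact image, where polynomials are uniformly dense.\<close>

lemma trig_polynomial_approx:
  fixes \<phi> :: "real ^ 'n \<Rightarrow> real"
  assumes cont: "continuous_on (cbox 0 1) \<phi>"
    and bd: "\<And>x. x \<in> cbox 0 1 - box 0 1 \<Longrightarrow> \<phi> x = 0" and "e > 0"
  obtains t where "trig_polynomial t" "\<And>x. x \<in> cbox 0 1 \<Longrightarrow> \<bar>\<phi> x - t x\<bar> < e"
proof -
  let ?Q = "cbox 0 1 :: (real ^ 'n) set"
  define F where "F s = \<phi> (SOME x. x \<in> ?Q \<and> circles x = s)" for s
  have F: "F (circles x) = \<phi> x" if "x \<in> ?Q" for x
  proof -
    define y where "y = (SOME y. y \<in> ?Q \<and> circles y = circles x)"
    have "y \<in> ?Q \<and> circles y = circles x"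
      unfolding y_def by (rule someI[of _ x]) (use that in simp)
    then have "\<phi> y = \<phi> x"
      using circles_eq[of y x] bd[of x] bd[of y] that by auto
    then show ?thesis by (simp add: F_def y_def)
  qed
  \<comment> \<open>A continuous surjection from a compact space to a Hausdorff space is a quotient
    map. Continuity of F then follows from that of its composition with \<open>circles\<close>,
    although F is defined by an arbitrary choice of preimages.\<close>
  have "quotient_map (top_of_set ?Q) (top_of_set (circles ` ?Q)) circles"
    by (rule T1_Spaces.continuous_imp_quotient_map)
       (use continuous_on_circles[of ?Q] in
         \<open>auto simp: compact_space_subtopology Hausdorff_space_subtopology\<close>)
  moreover have "continuous_map (top_of_set ?Q) euclidean (F \<circ> circles)"
    using cont F by (simp cong: continuous_on_cong)
  ultimately have "continuous_map (top_of_set (circles ` ?Q)) euclidean F"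
    by (rule continuous_compose_quotient_map)
  then have "continuous_on (circles ` ?Q) F" by simp
  moreover have "compact (circles ` ?Q)"
    by (intro compact_continuous_image continuous_on_circles) auto
  ultimately obtain p where p: "real_polynomial_function p"
      "\<And>s. s \<in> circles ` ?Q \<Longrightarrow> \<bar>F s - p s\<bar> < e"
    using Stone_Weierstrass_real_polynomial_function[OF _ _ \<open>e > 0\<close>] by metis
  show ?thesis
  proof (rule that)
    show "trig_polynomial (\<lambda>x. p (circles x))" using p(1) by (rule trig_polynomial_circles)
    show "\<bar>\<phi> x - p (circles x)\<bar> < e" if "x \<in> ?Q" for x
      using p(2)[of "circles x"] F[OF that] that by auto
  qed
qed

lemma trig_polynomial_continuous: "trig_polynomial t \<Longrightarrow> continuous_on S t"
proof (induction rule: trig_polynomial.induct)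
  case (monomial k a b)
  show ?case unfolding trig_monomial_def by (intro continuous_intros)
qed (intro continuous_on_add)

section \<open>Uniqueness of Fourier coefficients of integrable functions\<close>

lemma integrable_torus_mult_bounded:
  fixes f g :: "real ^ 'n \<Rightarrow> real"
  assumes f: "integrable torus f" and g: "g \<in> borel_measurable torus"
    and B: "\<And>x. x \<in> cbox 0 1 \<Longrightarrow> \<bar>g x\<bar> \<le> B"
  shows "integrable torus (\<lambda>x. f x * g x)"
proof (rule Bochner_Integration.integrable_bound)
  show "integrable torus (\<lambda>x. B * \<bar>f x\<bar>)" using f by simp
  show "(\<lambda>x. f x * g x) \<in> borel_measurable torus" using f g by measurable
  show "AE x in torus. norm (f x * g x) \<le> norm (B * \<bar>f x\<bar>)"
  proof (rule AE_I2)
    fix x :: "real ^ 'n" assume "x \<in> space torus"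
    then have "\<bar>g x\<bar> \<le> \<bar>B\<bar>" using B[of x] by (simp add: space_torus)
    then have "\<bar>f x\<bar> * \<bar>g x\<bar> \<le> \<bar>f x\<bar> * \<bar>B\<bar>" by (intro mult_left_mono) auto
    then show "norm (f x * g x) \<le> norm (B * \<bar>f x\<bar>)" by (simp add: abs_mult mult.commute)
  qed
qed

lemma integrable_torus_mult_continuous:
  fixes f g :: "real ^ 'n \<Rightarrow> real"
  assumes f: "integrable torus f" and g: "continuous_on UNIV g"
  shows "integrable torus (\<lambda>x. f x * g x)"
proof -
  have "bounded (g ` cbox 0 1)"
    by (intro compact_imp_bounded compact_continuous_image continuous_on_subset[OF g]) auto
  then obtain B where "\<And>x. x \<in> cbox 0 1 \<Longrightarrow> \<bar>g x\<bar> \<le> B"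
    by (auto simp: bounded_iff)
  then show ?thesis
    by (intro integrable_torus_mult_bounded[OF f] borel_measurable_torus borel_measurable_continuous_onI g)
qed

text \<open>The ideal test function is the sign of f. It is an almost-everywhere limit of continuous
  functions; clamped to [-1, 1] and multiplied by a weight that vanishes outside the open cube,
  these become admissible, and dominated convergence shows that |f| has integral 0 against the
  weight.\<close>

lemma AE_torus_zero_if_orthogonal_continuous:
  fixes f :: "real ^ 'n \<Rightarrow> real"
  assumes f: "integrable torus f"
    and orth: "\<And>\<phi>. continuous_on UNIV \<phi> \<Longrightarrow> (\<And>x. x \<notin> box 0 1 \<Longrightarrow> \<phi> x = 0) \<Longrightarrow>
                 (LINT x|torus. f x * \<phi> x) = 0"
  shows "AE x in torus. f x = 0"
proof -
  let ?Q = "cbox 0 1 :: (real ^ 'n) set" and ?B = "box 0 1 :: (real ^ 'n) set"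
  define s where "s x = (if x \<in> ?Q then sgn (f x) else 0)" for x
  have "f \<in> borel_measurable (restrict_space borel ?Q)"
    using f by (simp add: torus_def borel_measurable_integrable cong: measurable_cong_sets)
  then have "s \<in> borel_measurable borel"
    unfolding s_def by (intro measurable_restrict_space_iff[THEN iffD1]) auto
  then have "s measurable_on UNIV"
    by (intro lebesgue_measurable_imp_measurable_on) (auto simp: measurable_completion)
  then obtain N g where N: "negligible N" and g: "\<And>n :: nat. continuous_on UNIV (g n)"
      and lim: "\<And>x. x \<notin> N \<Longrightarrow> (\<lambda>n. g n x) \<longlonglongrightarrow> s x"
    unfolding measurable_on_def by auto
  \<comment> \<open>The distance to the complement of the open cube: continuous, positive exactly
    inside, so a zero integral of \<open>\<bar>f x\<bar> * \<eta> x\<close> still forces f to vanish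
    almost everywhere.\<close>
  define \<eta> where "\<eta> x = infdist x (- ?B)" for x
  define \<phi> where "\<phi> n x = max (-1) (min 1 (g n x)) * \<eta> x" for n x
  have \<eta>c: "continuous_on UNIV \<eta>" unfolding \<eta>_def by (intro continuous_intros)
  have \<phi>c: "continuous_on UNIV (\<phi> n)" for n
    unfolding \<phi>_def by (intro continuous_intros \<eta>c g)
  have ne: "- ?B \<noteq> {}"
    using mem_box_cart(1)[of 0 0 "1 :: real ^ 'n"] by auto
  have \<eta>0: "\<eta> x = 0 \<longleftrightarrow> x \<notin> ?B" for x
    unfolding \<eta>_def using in_closed_iff_infdist_zero[of "- ?B" x] ne by auto
  have \<eta>_nonneg: "0 \<le> \<eta> x" for x unfolding \<eta>_def by (rule infdist_nonneg)
  have "(\<lambda>n. LINT x|torus. f x * \<phi> n x) \<longlonglongrightarrow> (LINT x|torus. \<bar>f x\<bar> * \<eta> x)"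
  proof (rule integral_dominated_convergence[where w = "\<lambda>x. \<bar>f x\<bar> * \<eta> x"])
    show "(\<lambda>x. \<bar>f x\<bar> * \<eta> x) \<in> borel_measurable torus" "integrable torus (\<lambda>x. \<bar>f x\<bar> * \<eta> x)"
      using integrable_torus_mult_continuous[OF _ \<eta>c, of "\<lambda>x. \<bar>f x\<bar>"] f
      by (auto intro: borel_measurable_integrable)
    show "(\<lambda>x. f x * \<phi> n x) \<in> borel_measurable torus" for n
      by (intro borel_measurable_integrable integrable_torus_mult_continuous f \<phi>c)
    show "AE x in torus. (\<lambda>n. f x * \<phi> n x) \<longlonglongrightarrow> \<bar>f x\<bar> * \<eta> x"
    proof (rule AE_torusI_negligible[OF N])
      fix x assume x: "x \<in> ?Q" "x \<notin> N"
      have "(\<lambda>n. f x * \<phi> n x) \<longlonglongrightarrow> f x * (max (-1) (min 1 (s x)) * \<eta> x)"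
        unfolding \<phi>_def by (intro tendsto_intros lim x)
      moreover have "f x * (max (-1) (min 1 (s x)) * \<eta> x) = \<bar>f x\<bar> * \<eta> x"
        using x by (auto simp: s_def sgn_if)
      ultimately show "(\<lambda>n. f x * \<phi> n x) \<longlonglongrightarrow> \<bar>f x\<bar> * \<eta> x" by simp
    qed
    show "AE x in torus. norm (f x * \<phi> n x) \<le> \<bar>f x\<bar> * \<eta> x" for n
    proof (rule AE_I2)
      fix x
      have "\<bar>max (-1) (min 1 (g n x))\<bar> * \<eta> x \<le> 1 * \<eta> x"
        by (intro mult_right_mono \<eta>_nonneg) auto
      then have "\<bar>\<phi> n x\<bar> \<le> \<eta> x" using \<eta>_nonneg[of x] by (simp add: \<phi>_def abs_mult)
      then show "norm (f x * \<phi> n x) \<le> \<bar>f x\<bar> * \<eta> x" by (simp add: abs_mult mult_left_mono)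
    qed
  qed
  moreover have "(LINT x|torus. f x * \<phi> n x) = 0" for n
    by (rule orth[OF \<phi>c]) (simp add: \<phi>_def \<eta>0)
  ultimately have "(LINT x|torus. \<bar>f x\<bar> * \<eta> x) = 0"
    by (simp add: LIMSEQ_const_iff)
  then have "AE x in torus. \<bar>f x\<bar> * \<eta> x = 0"
    using integrable_torus_mult_continuous[OF _ \<eta>c, of "\<lambda>x. \<bar>f x\<bar>"] f \<eta>_nonneg
    by (subst (asm) integral_nonneg_eq_0_iff_AE) auto
  moreover have "AE x in torus. x \<in> ?B"
    by (rule AE_torusI_negligible[OF negligible_frontier_interval]) auto
  ultimately show ?thesis
    by eventually_elim (use \<eta>0 in auto)
qed

lemma AE_torus_zero_if_orthogonal_trig:
  fixes f :: "real ^ 'n \<Rightarrow> real"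
  assumes f: "integrable torus f"
    and orth: "\<And>a b k. k \<in> int_vecs \<Longrightarrow> (LINT x|torus. f x * trig_monomial a b k x) = 0"
  shows "AE x in torus. f x = 0"
proof (rule AE_torus_zero_if_orthogonal_continuous[OF f])
  fix \<phi> :: "real ^ 'n \<Rightarrow> real"
  assume c: "continuous_on UNIV \<phi>" and bd: "\<And>x. x \<notin> box 0 1 \<Longrightarrow> \<phi> x = 0"
  have t0: "(LINT x|torus. f x * t x) = 0" if "trig_polynomial t" for t
    using that
  proof (induction rule: trig_polynomial.induct)
    case (add t u)
    then show ?case
      by (simp add: distrib_left integrable_torus_mult_continuous f trig_polynomial_continuous)
  qed (rule orth)
  define A where "A = (LINT x|torus. \<bar>f x\<bar>)"
  have "\<bar>LINT x|torus. f x * \<phi> x\<bar> \<le> 0 + e" if "e > 0" for e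
  proof -
    \<comment> \<open>The integral of f against \<phi> equals the one against
      \<open>\<phi> - t\<close>, which is at most A times the uniform error. Using A + 1 in the
      denominator covers the case A = 0.\<close>
    have "0 < e / (A + 1)" using that by (simp add: A_def add_nonneg_pos)
    then obtain t where t: "trig_polynomial t" "\<And>x. x \<in> cbox 0 1 \<Longrightarrow> \<bar>\<phi> x - t x\<bar> < e / (A + 1)"
      using trig_polynomial_approx[OF continuous_on_subset[OF c], of "e / (A + 1)"] bd by auto
    have i: "integrable torus (\<lambda>x. f x * t x)" "integrable torus (\<lambda>x. f x * \<phi> x)"
      by (intro integrable_torus_mult_continuous f c trig_polynomial_continuous t)+
    have "(LINT x|torus. f x * \<phi> x) = (LINT x|torus. f x * \<phi> x - f x * t x)"
      using i t0[OF t(1)] by simp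
    also have "\<bar>\<dots>\<bar> \<le> (LINT x|torus. \<bar>f x * \<phi> x - f x * t x\<bar>)"
      by (rule integral_abs_bound)
    also have "\<dots> \<le> (LINT x|torus. \<bar>f x\<bar> * (e / (A + 1)))"
    proof (rule integral_mono)
      fix x :: "real ^ 'n" assume "x \<in> space torus"
      then have "\<bar>f x\<bar> * \<bar>\<phi> x - t x\<bar> \<le> \<bar>f x\<bar> * (e / (A + 1))"
        using t(2)[of x] by (intro mult_left_mono) (auto simp: space_torus)
      then show "\<bar>f x * \<phi> x - f x * t x\<bar> \<le> \<bar>f x\<bar> * (e / (A + 1))"
        by (simp add: abs_mult flip: right_diff_distrib)
    qed (use i f in auto)
    also have "\<dots> = A * (e / (A + 1))" by (simp add: A_def)
    also have "\<dots> \<le> e"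
    proof -
      have "0 \<le> A" by (simp add: A_def)
      then show ?thesis using that by (simp add: field_simps)
    qed
    finally show ?thesis by simp
  qed
  then have "\<bar>LINT x|torus. f x * \<phi> x\<bar> \<le> 0" by (rule field_le_epsilon)
  then show "(LINT x|torus. f x * \<phi> x) = 0" by simp
qed

text \<open>Translation by half a period along k changes the sign of the mode but not its
  integral.\<close>

lemma integral_trig_monomial:
  assumes k: "k \<in> int_vecs" "k \<noteq> 0"
  shows "(LINT x|torus. trig_monomial a b k x) = 0"
proof -
  let ?t = "trig_monomial a b k"
  \<comment> \<open>Scaled so that \<open>k \<bullet> y\<close> is 1/2, which shifts the phase by
    pi.\<close>
  define y where "y = (1 / (2 * (k \<bullet> k))) *\<^sub>R k"
  have "2 * pi * (k \<bullet> (x + y)) = 2 * pi * (k \<bullet> x) + pi" for x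
    using k(2) by (simp add: y_def inner_add_right field_simps)
  then have "?t (x + y) = - ?t x" for x
    by (simp add: trig_monomial_def)
  moreover have c: "continuous_on UNIV ?t"
    by (intro trig_polynomial_continuous trig_polynomial.monomial k)
  then have "(LINT x|torus. ?t (x + y)) = (LINT x|torus. ?t x)"
    using torus_smoothD(1)[OF trig_monomial_smooth[OF k(1)]]
    by (intro integral_torus_shift integrable_torus_continuous borel_measurable_continuous_onI)
  ultimately show ?thesis by simp
qed

text \<open>Testing against the eigenfunctions of the Laplacian annihilates all Fourier coefficients
  except the mean.\<close>

lemma weakly_harmonic_AE_const:
  fixes f :: "real ^ 'n \<Rightarrow> real"
  assumes "weakly_harmonic f"
  shows "AE x in torus. f x = (LINT x|torus. f x)"
proof -
  interpret prob_space "torus :: (real ^ 'n) measure" by (rule prob_space_torus)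
  have f: "integrable torus f" using assms by (simp add: weakly_harmonic_def)
  define m where "m = (LINT x|torus. f x)"
  have "AE x in torus. f x - m = 0"
  proof (rule AE_torus_zero_if_orthogonal_trig)
    show "integrable torus (\<lambda>x. f x - m)" using f by simp
    fix a b and k :: "real ^ 'n" assume k: "k \<in> int_vecs"
    show "(LINT x|torus. (f x - m) * trig_monomial a b k x) = 0"
    proof (cases "k = 0")
      case True
      have "(LINT x|torus. (f x - m) * a) = 0"
        using f by (simp add: m_def prob_space)
      then show ?thesis using True by (simp add: trig_monomial_def)
    next
      case False
      have "(LINT x|torus. f x * laplacian (trig_monomial a b k) x) = 0"
        using assms trig_monomial_smooth[OF k] by (simp add: weakly_harmonic_def)
      then have "(LINT x|torus. - (4 * pi\<^sup>2 * (norm k)\<^sup>2) * (f x * trig_monomial a b k x)) = 0"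
        unfolding laplacian_trig_monomial by (simp only: mult.left_commute)
      then have "(LINT x|torus. f x * trig_monomial a b k x) = 0"
        using False by (subst (asm) integral_mult_right_zero) auto
      moreover have "continuous_on UNIV (trig_monomial a b k)"
        by (intro trig_polynomial_continuous trig_polynomial.monomial k)
      moreover from this have "integrable torus (\<lambda>x. f x * trig_monomial a b k x)"
        "integrable torus (trig_monomial a b k)"
        using f by (auto intro: integrable_torus_mult_continuous integrable_torus_continuous)
      ultimately show ?thesis
        using integral_trig_monomial[OF k False, of a b] by (simp add: left_diff_distrib)
    qed
  qed
  then show ?thesis by (simp add: m_def)
qed

subsection \<open>Radial kernels\<close>

lemma closed_int_vecs: "closed (int_vecs :: (real ^ 'n) set)"
proof -
  have eq: "(int_vecs :: (real ^ 'n) set) = (\<Inter>i. (\<lambda>k. k $ i) -` \<int>)" by (auto simp: int_vecs_def)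
  show ?thesis
    unfolding eq by (intro closed_INT ballI continuous_closed_vimage closed_Ints continuous_intros)
qed

lemma torus_norm_eqE:
  assumes "torus_norm z = t"
  obtains k where "k \<in> int_vecs" "dist z k = t"
  using infdist_attains_inf[OF closed_int_vecs, of z] assms
  by (metis empty_iff int_vecs_simps(1) torus_norm_def)

lemma continuous_torus_norm: "continuous_on S torus_norm"
  unfolding torus_norm_def by (intro continuous_intros)

text \<open>The distance to the closed lattice is attained, so a level set lies in the union of the
  countably many spheres of radius t around the points x - k.\<close>

lemma negligible_torus_norm_level: "negligible {y. torus_norm (x - y) = t}"
proof (rule negligible_subset)
  show "negligible (\<Union>k\<in>int_vecs. sphere (x - k) t)"
    by (rule negligible_countable_Union)
       (auto intro: countable_image countable_int_vecs negligible_sphere)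
  show "{y. torus_norm (x - y) = t} \<subseteq> (\<Union>k\<in>int_vecs. sphere (x - k) t)"
  proof clarify
    fix y assume "t = torus_norm (x - y)"
    then obtain k where "k \<in> int_vecs" "dist (x - y) k = torus_norm (x - y)"
      using torus_norm_eqE by metis
    moreover have "dist (x - y) k = dist (x - k) y"
      by (simp add: dist_norm algebra_simps)
    ultimately show "y \<in> (\<Union>k\<in>int_vecs. sphere (x - k) (torus_norm (x - y)))" by auto
  qed
qed

lemma admissible_kernel_profile:
  assumes "admissible_kernel W"
  obtains h where "mono h" "\<And>x. W x = - h (torus_norm x)"
proof -
  have nonneg: "\<And>x. 0 \<le> W x" and anti: "\<And>x y. torus_norm x \<le> torus_norm y \<Longrightarrow> W y \<le> W x"
    using assms unfolding admissible_kernel_def by blast+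
  have bdd: "bdd_below (W ` A)" for A
    using nonneg by (intro bdd_belowI[of _ 0]) auto
  \<comment> \<open>The infimum over a sublevel set gives a monotone function on the whole real
    line, also at values that \<open>torus_norm\<close> does not take; \<open>max 0\<close> keeps
    the set nonempty for negative t. The minus sign turns the decreasing profile into an increasing
    one, to which the facts on \<open>mono\<close> apply.\<close>
  define h where "h t = - (INF x\<in>{x. torus_norm x \<le> max 0 t}. W x)" for t
  have ne: "0 \<in> {x. torus_norm x \<le> max 0 t}" for t
    by (simp add: torus_norm_def infdist_zero)
  show ?thesis
  proof (rule that)
    show "mono h"
      unfolding h_def by (intro monoI le_imp_neg_le cINF_superset_mono bdd) (use ne in auto)
    show "W x = - h (torus_norm x)" for x
    proof -
      have "max 0 (torus_norm x) = torus_norm x" by (simp add: torus_norm_def infdist_nonneg)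
      moreover have "(INF y\<in>{y. torus_norm y \<le> torus_norm x}. W y) = W x"
      proof (rule antisym)
        show "(INF y\<in>{y. torus_norm y \<le> torus_norm x}. W y) \<le> W x"
          by (rule cINF_lower[OF bdd]) simp
        show "W x \<le> (INF y\<in>{y. torus_norm y \<le> torus_norm x}. W y)"
          by (rule cINF_greatest) (blast, use anti in blast)
      qed
      ultimately show ?thesis by (simp add: h_def)
    qed
  qed
qed

lemma borel_measurable_admissible_kernel:
  assumes "admissible_kernel W"
  shows "W \<in> borel_measurable borel"
proof -
  obtain h where h: "mono h" "\<And>x. W x = - h (torus_norm x)"
    using admissible_kernel_profile[OF assms] by blast
  have "(\<lambda>x. - h (torus_norm x)) \<in> borel_measurable borel"
    by (intro borel_measurable_uminus measurable_compose[OF _ borel_measurable_mono[OF h(1)]]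
          borel_measurable_continuous_onI continuous_torus_norm)
  then show ?thesis by (simp add: h(2)[abs_def])
qed

text \<open>A monotone profile has countably many discontinuities, and W is continuous at every
  point whose lattice distance avoids them. The reflection \<open>x - y\<close> is the form in which
  a convolution meets the bad set.\<close>

lemma negligible_admissible_kernel_discont:
  fixes W :: "real ^ 'n \<Rightarrow> real"
  assumes "admissible_kernel W"
  shows "negligible {y. \<not> isCont W (x - y)}"
proof -
  obtain h where h: "mono h" "\<And>x. W x = - h (torus_norm x)"
    using admissible_kernel_profile[OF assms] by blast
  show ?thesis
  proof (rule negligible_subset)
    show "negligible (\<Union>t\<in>{t. \<not> isCont h t}. {y. torus_norm (x - y) = t})"
      by (rule negligible_countable_Union)
         (auto intro: countable_image mono_ctble_discont h negligible_torus_norm_level)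
    show "{y. \<not> isCont W (x - y)} \<subseteq> (\<Union>t\<in>{t. \<not> isCont h t}. {y. torus_norm (x - y) = t})"
    proof clarify
      fix y assume *: "\<not> isCont W (x - y)"
      have "continuous_on UNIV (torus_norm :: real ^ 'n \<Rightarrow> real)" by (rule continuous_torus_norm)
      then have "isCont torus_norm (x - y)" by (simp add: continuous_on_eq_continuous_at)
      have "isCont (\<lambda>z. - h (torus_norm z)) (x - y)" if "isCont h (torus_norm (x - y))"
        by (rule isCont_minus, rule isCont_o2) fact+
      then show "y \<in> (\<Union>t\<in>{t. \<not> isCont h t}. {y. torus_norm (x - y) = t})"
        using * by (auto simp: h(2)[abs_def])
    qed
  qed
qed

subsection \<open>Convolution on the torus\<close>

lemma measurable_ident_torus [measurable]: "(\<lambda>x. x) \<in> torus \<rightarrow>\<^sub>M borel"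
  by (rule borel_measurable_torus) simp

lemma Zperiodic_torus_conv: "Zperiodic f \<Longrightarrow> Zperiodic (torus_conv f g)"
  unfolding Zperiodic_def torus_conv_def by (simp add: diff_add_eq[symmetric])

lemma torus_conv_cong_AE:
  assumes [measurable]: "f \<in> borel_measurable borel" "g \<in> borel_measurable torus" "h \<in> borel_measurable torus"
    and "AE y in torus. g y = h y"
  shows "torus_conv f g = torus_conv f h"
  unfolding torus_conv_def fun_eq_iff
  by (intro allI integral_cong_AE) (measurable, use assms(4) in auto)

lemma integrable_torus_conv:
  fixes f g :: "real ^ 'n \<Rightarrow> real"
  assumes [measurable]: "f \<in> borel_measurable borel" and "\<And>z. \<bar>f z\<bar> \<le> B" "integrable torus g"
  shows "integrable torus (\<lambda>y. f (x - y) * g y)"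
proof -
  have "(\<lambda>y. f (x - y)) \<in> borel_measurable torus" by measurable
  then show ?thesis
    using integrable_torus_mult_bounded[OF assms(3), of "\<lambda>y. f (x - y)" B] assms(2)
    by (simp add: mult.commute)
qed

lemma torus_conv_bounded:
  fixes f g :: "real ^ 'n \<Rightarrow> real"
  assumes "f \<in> borel_measurable borel" "\<And>z. \<bar>f z\<bar> \<le> B" "integrable torus g"
  shows "\<bar>torus_conv f g x\<bar> \<le> B * (LINT y|torus. \<bar>g y\<bar>)"
proof -
  have "\<bar>torus_conv f g x\<bar> \<le> (LINT y|torus. \<bar>f (x - y) * g y\<bar>)"
    unfolding torus_conv_def by (rule integral_abs_bound)
  also have "\<dots> \<le> (LINT y|torus. B * \<bar>g y\<bar>)"
    using integrable_abs[OF integrable_torus_conv[OF assms]] assms(2,3)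
    by (intro integral_mono) (auto simp: abs_mult mult_right_mono)
  finally show ?thesis by simp
qed

lemma borel_measurable_torus_conv:
  fixes f g :: "real ^ 'n \<Rightarrow> real"
  assumes [measurable]: "f \<in> borel_measurable borel" "g \<in> borel_measurable torus"
  shows "torus_conv f g \<in> borel_measurable borel"
proof -
  interpret prob_space "torus :: (real ^ 'n) measure" by (rule prob_space_torus)
  show ?thesis unfolding torus_conv_def by measurable
qed

lemma continuous_torus_conv:
  fixes f g :: "real ^ 'n \<Rightarrow> real"
  assumes [measurable]: "f \<in> borel_measurable borel" and B: "\<And>z. \<bar>f z\<bar> \<le> B"
    and g: "integrable torus g" and cont: "\<And>x. negligible {y. \<not> isCont f (x - y)}"
  shows "continuous_on UNIV (torus_conv f g)"
proof -
  have "(\<lambda>n. torus_conv f g (X n)) \<longlonglongrightarrow> torus_conv f g x" if X: "X \<longlonglongrightarrow> x" for X x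
    unfolding torus_conv_def
  proof (rule integral_dominated_convergence[where w = "\<lambda>y. B * \<bar>g y\<bar>"])
    show "AE y in torus. (\<lambda>n. f (X n - y) * g y) \<longlonglongrightarrow> f (x - y) * g y"
    proof (rule AE_torusI_negligible[OF cont])
      fix y assume "y \<notin> {y. \<not> isCont f (x - y)}"
      then have "(\<lambda>n. f (X n - y)) \<longlonglongrightarrow> f (x - y)"
        using X by (intro isCont_tendsto_compose[of _ f] tendsto_intros) auto
      then show "(\<lambda>n. f (X n - y) * g y) \<longlonglongrightarrow> f (x - y) * g y" by (intro tendsto_intros)
    qed
  qed (use B g in \<open>auto intro!: borel_measurable_integrable integrable_torus_conv mult_right_mono
         simp: abs_mult\<close>)
  then show ?thesis by (auto simp: continuous_on_sequentially o_def)
qed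

lemma continuous_torus_conv_continuous:
  assumes f: "Zperiodic f" "continuous_on UNIV f" and g: "integrable torus g"
  shows "continuous_on UNIV (torus_conv f g)"
proof -
  obtain B where "\<And>z. \<bar>f z\<bar> \<le> B" using bounded_Zperiodic_continuous[OF f] by blast
  then show ?thesis
    using f(2) by (intro continuous_torus_conv[OF _ _ g] borel_measurable_continuous_onI)
       (auto simp: continuous_on_eq_continuous_at)
qed

text \<open>On a product of probability spaces the bounded integrand is integrable. The exchange
  leaves an integral of a translate of f against \<phi>, on which weak derivatives can act for each
  y separately.\<close>

lemma torus_conv_Fubini:
  fixes f g \<phi> :: "real ^ 'n \<Rightarrow> real"
  assumes [measurable]: "f \<in> borel_measurable borel" and B: "\<And>z. \<bar>f z\<bar> \<le> B"
    and g: "continuous_on UNIV g" and \<phi>: "continuous_on UNIV \<phi>"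
  shows "(LINT x|torus. torus_conv f g x * \<phi> x) = (LINT y|torus. g y * (LINT x|torus. f (x - y) * \<phi> x))"
proof -
  interpret prob_space "torus :: (real ^ 'n) measure" by (rule prob_space_torus)
  interpret P: pair_prob_space "torus :: (real ^ 'n) measure" "torus :: (real ^ 'n) measure" ..
  have [measurable]: "g \<in> borel_measurable torus" "\<phi> \<in> borel_measurable torus"
    using g \<phi> by (auto intro: borel_measurable_torus borel_measurable_continuous_onI)
  have "bounded (g ` cbox 0 1)" "bounded (\<phi> ` cbox 0 1)"
    by (intro compact_imp_bounded compact_continuous_image continuous_on_subset[OF g]
          continuous_on_subset[OF \<phi>]; simp)+
  then obtain G F where GF: "\<And>x. x \<in> cbox 0 1 \<Longrightarrow> \<bar>g x\<bar> \<le> G" "\<And>x. x \<in> cbox 0 1 \<Longrightarrow> \<bar>\<phi> x\<bar> \<le> F"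
    by (auto simp: bounded_iff)
  have "0 \<le> B" using B[of 0] by linarith
  have "\<bar>f (x - y) * g y * \<phi> x\<bar> \<le> B * G * F" if "x \<in> cbox 0 1" "y \<in> cbox 0 1" for x y
  proof -
    have "0 \<le> G" using GF(1)[OF that(2)] by linarith
    then show ?thesis
      unfolding abs_mult using GF that B \<open>0 \<le> B\<close> by (intro mult_mono) auto
  qed
  then have "integrable (torus \<Otimes>\<^sub>M torus) (\<lambda>(x, y). f (x - y) * g y * \<phi> x)"
    by (intro P.integrable_const_bound[where B = "B * G * F"] AE_I2)
       (auto simp: space_pair_measure space_torus)
  then have "(LINT y|torus. (LINT x|torus. f (x - y) * g y * \<phi> x)) =
      (LINT x|torus. (LINT y|torus. f (x - y) * g y * \<phi> x))"
    by (rule P.Fubini_integral)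
  moreover have "(LINT x|torus. f (x - y) * g y * \<phi> x) = g y * (LINT x|torus. f (x - y) * \<phi> x)" for y
    by (subst integral_mult_right_zero[symmetric]) (simp add: mult_ac)
  ultimately show ?thesis by (simp add: torus_conv_def)
qed

section \<open>Differentiation under the integral sign\<close>

lemma frechet_derivative_eq_partial_deriv:
  fixes f :: "real ^ 'n \<Rightarrow> real"
  assumes "f differentiable (at x)"
  shows "frechet_derivative f (at x) h = (\<chi> i. partial_deriv i f x) \<bullet> h"
proof -
  have l: "linear (frechet_derivative f (at x))"
    using assms by (rule linear_frechet_derivative)
  have "frechet_derivative f (at x) h = frechet_derivative f (at x) (\<Sum>i\<in>UNIV. (h $ i) *\<^sub>R axis i 1)"
    by (simp add: basis_expansion[of h] flip: scalar_mult_eq_scaleR)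
  also have "\<dots> = (\<Sum>i\<in>UNIV. h $ i * partial_deriv i f x)"
    by (simp add: linear_sum[OF l] linear_cmul[OF l] partial_deriv_def)
  finally show ?thesis by (simp add: inner_vec_def mult.commute)
qed

text \<open>The factor s serves two purposes: s = -1 is the convolution, while s = 1 with r = 1 is
  the integral of a translate, whose derivative must vanish for periodic functions.\<close>

lemma has_derivative_integral_shift:
  fixes f r :: "real ^ 'n \<Rightarrow> real"
  assumes f: "cont_diff (Suc 0) f" and r: "continuous_on UNIV r"
  shows "((\<lambda>x. LINT y|torus. f (x + s *\<^sub>R y) * r y) has_derivative
           (\<lambda>h. (\<chi> i. LINT y|torus. partial_deriv i f (x + s *\<^sub>R y) * r y) \<bullet> h)) (at x)"
proof -
  let ?Q = "cbox 0 1 :: (real ^ 'n) set"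
  define g where "g z = (\<chi> i. partial_deriv i f z)" for z
  \<comment> \<open>The derivative of the integrand in x, packaged as a bounded linear map because
    \<open>leibniz_rule\<close> integrates derivatives in that space.\<close>
  define D where "D x y = r y *\<^sub>R blinfun_inner_right (g (x + s *\<^sub>R y))" for x y
  have pc: "continuous_on UNIV (partial_deriv i f)" for i using f by simp
  have gc: "continuous_on UNIV g" unfolding g_def by (intro continuous_on_vec_lambda pc)
  have fc: "continuous_on UNIV f" by (rule cont_diff_imp_continuous[OF f])
  have shift: "continuous_on ?Q (\<lambda>y. u (x + s *\<^sub>R y) * r y)"
    if "continuous_on UNIV u" for u :: "real ^ 'n \<Rightarrow> real" and x
    by (intro continuous_intros continuous_on_subset[OF r] continuous_on_compose2[OF that]) auto
  have LI: "integral ?Q (\<lambda>y. u (x + s *\<^sub>R y) * r y) = (LINT y|torus. u (x + s *\<^sub>R y) * r y)"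
    if "continuous_on UNIV u" for u :: "real ^ 'n \<Rightarrow> real" and x
    by (intro integral_unique has_integral_torus_continuous shift that)
  have Dc: "continuous_on (UNIV \<times> ?Q) (\<lambda>(x, y). D x y)"
  proof -
    have "continuous_on (UNIV \<times> ?Q) (\<lambda>p. g (fst p + s *\<^sub>R snd p))"
      by (rule continuous_on_compose2[OF gc]) (auto intro!: continuous_intros)
    moreover have "continuous_on (UNIV \<times> ?Q) (\<lambda>p :: (real ^ 'n) \<times> (real ^ 'n). r (snd p))"
      by (rule continuous_on_compose2[OF r]) (auto intro!: continuous_intros)
    ultimately show ?thesis
      unfolding D_def case_prod_beta
      by (intro continuous_on_scaleR bounded_linear.continuous_on[OF bounded_linear_blinfun_inner_right])
  qed
  have "((\<lambda>x. integral ?Q (\<lambda>y. f (x + s *\<^sub>R y) * r y)) has_derivative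
      blinfun_apply (integral ?Q (D x))) (at x within UNIV)"
  proof (rule leibniz_rule)
    fix x y
    have d: "f differentiable (at (x + s *\<^sub>R y))" using f by simp
    have "frechet_derivative f (at (x + s *\<^sub>R y)) = (\<lambda>h. g (x + s *\<^sub>R y) \<bullet> h)"
      unfolding g_def by (intro ext frechet_derivative_eq_partial_deriv d)
    with d have "(f has_derivative (\<lambda>h. g (x + s *\<^sub>R y) \<bullet> h)) (at (x + s *\<^sub>R y))"
      by (simp only: frechet_derivative_works)
    then have "((\<lambda>x. f (x + s *\<^sub>R y)) has_derivative (\<lambda>h. g (x + s *\<^sub>R y) \<bullet> h)) (at x)"
      by (simp add: has_derivative_shift_iff)
    from has_derivative_mult_left[OF this, of "r y"]
    show "((\<lambda>x. f (x + s *\<^sub>R y) * r y) has_derivative blinfun_apply (D x y)) (at x within UNIV)"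
      by (simp add: D_def scaleR_blinfun.rep_eq mult.commute)
  next
    show "(\<lambda>y. f (x + s *\<^sub>R y) * r y) integrable_on ?Q" for x
      by (intro integrable_continuous shift fc)
  qed (use Dc in auto)
  moreover have "blinfun_apply (integral ?Q (D x))
      = (\<lambda>h. (\<chi> i. LINT y|torus. partial_deriv i f (x + s *\<^sub>R y) * r y) \<bullet> h)"
  proof
    fix h
    have "continuous_on ?Q (D x)"
    proof -
      have "continuous_on ?Q (\<lambda>y. (x, y))" by (intro continuous_on_Pair continuous_on_const continuous_on_id)
      from continuous_on_compose2[OF Dc this] show ?thesis by auto
    qed
    then have "D x integrable_on ?Q" by (rule integrable_continuous)
    then have "integral ?Q (D x) h = integral ?Q (\<lambda>y. D x y h)"
      by (rule integral_linear[OF _ blinfun.bounded_linear_left, unfolded o_def, symmetric])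
    also have "(\<lambda>y. D x y h) = (\<lambda>y. \<Sum>i\<in>UNIV. h $ i * (partial_deriv i f (x + s *\<^sub>R y) * r y))"
      by (simp add: D_def g_def scaleR_blinfun.rep_eq inner_vec_def sum_distrib_left mult_ac)
    also have "integral ?Q \<dots> = (\<Sum>i\<in>UNIV. h $ i * integral ?Q (\<lambda>y. partial_deriv i f (x + s *\<^sub>R y) * r y))"
      by (subst integral_sum) (auto intro!: integrable_continuous continuous_on_mult continuous_on_const shift pc)
    finally show "integral ?Q (D x) h = (\<chi> i. LINT y|torus. partial_deriv i f (x + s *\<^sub>R y) * r y) \<bullet> h"
      unfolding LI[OF pc] by (simp add: inner_vec_def mult.commute)
  qed
  ultimately show ?thesis by (simp add: LI[OF fc])
qed

text \<open>Every derivative falls on f, so g stays merely continuous through the induction and no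
  bootstrap on the regularity of the density arises.\<close>

lemma cont_diff_torus_conv:
  assumes "Zperiodic f" "cont_diff k f" and g: "continuous_on UNIV g"
  shows "cont_diff k (torus_conv f g)"
  using assms(1,2)
proof (induction k arbitrary: f)
  case 0
  then show ?case by (simp add: continuous_torus_conv_continuous integrable_torus_continuous g)
next
  case (Suc k)
  have "cont_diff (Suc 0) f"
    using Suc.prems by (auto dest: cont_diff_imp_continuous)
  note D = has_derivative_integral_shift[OF this g, of "-1"]
  have "torus_conv f g = (\<lambda>x. LINT y|torus. f (x + (-1) *\<^sub>R y) * g y)"
    by (simp add: torus_conv_def fun_eq_iff)
  note D = D[folded this]
  have "partial_deriv i (torus_conv f g) = torus_conv (partial_deriv i f) g" for i
    by (rule ext, subst partial_deriv_eq[OF D]) (simp add: torus_conv_def inner_axis)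
  then show ?case
    using Suc.prems differentiableI[OF D]
    by (simp add: Suc.IH Zperiodic_partial_deriv)
qed

text \<open>The integral of a translate of \<phi> does not depend on the translation;
  differentiating this constant under the integral sign gives 0.\<close>

lemma integral_partial_deriv_smooth:
  assumes "\<phi> \<in> torus_smooth"
  shows "(LINT x|torus. partial_deriv i \<phi> x) = 0"
proof -
  note \<phi> = torus_smoothD[OF assms]
  have "(\<lambda>x. LINT y|torus. \<phi> (x + 1 *\<^sub>R y) * 1) = (\<lambda>x. LINT y|torus. \<phi> y)"
    using integral_torus_shift[OF borel_measurable_continuous_onI \<phi>(1) integrable_torus_continuous]
      cont_diff_imp_continuous[OF \<phi>(2)] by (simp add: add.commute)
  moreover have "((\<lambda>x. LINT y|torus. \<phi> (x + 1 *\<^sub>R y) * 1) has_derivative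
      (\<lambda>h. (\<chi> i. LINT y|torus. partial_deriv i \<phi> (0 + 1 *\<^sub>R y) * 1) \<bullet> h)) (at 0)"
    by (intro has_derivative_integral_shift \<phi>) auto
  ultimately have "((\<lambda>x :: real ^ 'a. LINT y|torus. \<phi> y) has_derivative
      (\<lambda>h. (\<chi> i. LINT y|torus. partial_deriv i \<phi> y) \<bullet> h)) (at 0)" by simp
  from partial_deriv_eq[OF this, of i] partial_deriv_eq[OF has_derivative_const, of i "LINT y|torus. \<phi> y" 0]
  show ?thesis by (simp add: inner_axis)
qed

subsection \<open>Weak gradients\<close>

lemma integrable_vec_nth:
  "integrable M (g :: 'a \<Rightarrow> real ^ 'n) \<Longrightarrow> integrable M (\<lambda>x. g x $ i)"
  by (rule integrable_bounded_linear[OF bounded_linear_vec_nth])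

text \<open>Trigonometric monomials are smooth test functions, so each component of the difference
  is orthogonal to all of them.\<close>

lemma weak_gradient_unique:
  assumes "has_weak_gradient f g" "has_weak_gradient f h"
  shows "AE x in torus. g x = h x"
proof -
  have i: "integrable torus (\<lambda>x. g x $ i)" "integrable torus (\<lambda>x. h x $ i)" for i
    using assms by (auto simp: has_weak_gradient_def intro: integrable_vec_nth)
  have "AE x in torus. g x $ i - h x $ i = 0" for i
  proof (rule AE_torus_zero_if_orthogonal_trig)
    show "integrable torus (\<lambda>x. g x $ i - h x $ i)" by (intro Bochner_Integration.integrable_diff i)
    fix a b and k :: "real ^ 'a" assume k: "k \<in> int_vecs"
    let ?t = "trig_monomial a b k"
    have "(LINT x|torus. f x * partial_deriv i ?t x) = - (LINT x|torus. g x $ i * ?t x)"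
      "(LINT x|torus. f x * partial_deriv i ?t x) = - (LINT x|torus. h x $ i * ?t x)"
      using assms trig_monomial_smooth[OF k] by (auto simp: has_weak_gradient_def)
    moreover have "continuous_on UNIV ?t"
      by (intro trig_polynomial_continuous trig_polynomial.monomial k)
    ultimately show "(LINT x|torus. (g x $ i - h x $ i) * ?t x) = 0"
      by (simp add: left_diff_distrib integrable_torus_mult_continuous i)
  qed
  then have "AE x in torus. \<forall>i\<in>UNIV. g x $ i - h x $ i = 0"
    by (intro AE_finite_allI) auto
  then show ?thesis by eventually_elim (simp add: vec_eq_iff)
qed

lemma has_weak_gradient_affine:
  fixes f :: "real ^ 'n \<Rightarrow> real"
  assumes "has_weak_gradient f g"
  shows "has_weak_gradient (\<lambda>x. a + b * f x) (\<lambda>x. b *\<^sub>R g x)"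
proof -
  interpret prob_space "torus :: (real ^ 'n) measure" by (rule prob_space_torus)
  have f: "integrable torus f" using assms by (simp add: has_weak_gradient_def)
  have "(LINT x|torus. (a + b * f x) * partial_deriv i \<phi> x) = - (LINT x|torus. (b *\<^sub>R g x) $ i * \<phi> x)"
    if \<phi>: "\<phi> \<in> torus_smooth" for \<phi> i
  proof -
    have c: "continuous_on UNIV (partial_deriv i \<phi>)" using torus_smoothD(2)[OF \<phi>, of 1] by simp
    have "(LINT x|torus. (a + b * f x) * partial_deriv i \<phi> x)
        = (LINT x|torus. a * partial_deriv i \<phi> x + b * (f x * partial_deriv i \<phi> x))"
      by (simp add: algebra_simps)
    also have "\<dots> = a * (LINT x|torus. partial_deriv i \<phi> x) + b * (LINT x|torus. f x * partial_deriv i \<phi> x)"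
      by (simp add: integrable_torus_continuous[OF c] integrable_torus_mult_continuous[OF f c])
    also have "\<dots> = - (b * (LINT x|torus. g x $ i * \<phi> x))"
      using assms \<phi> by (simp add: has_weak_gradient_def integral_partial_deriv_smooth)
    finally show ?thesis by (simp add: mult.assoc)
  qed
  then show ?thesis using assms by (simp add: has_weak_gradient_def Zperiodic_def)
qed

lemma has_weak_gradient_cong_AE:
  assumes "has_weak_gradient f g" "Zperiodic h" "h \<in> borel_measurable torus" "AE x in torus. g x = h x"
  shows "has_weak_gradient f h"
proof -
  have g: "g \<in> borel_measurable torus" "integrable torus g"
    using assms(1) by (auto simp: has_weak_gradient_def)
  then have "integrable torus h"
    using assms by (subst integrable_cong_AE[symmetric, of g]) auto
  moreover have "(LINT x|torus. g x $ i * \<phi> x) = (LINT x|torus. h x $ i * \<phi> x)"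
    if \<phi>: "\<phi> \<in> torus_smooth" for \<phi> i
  proof (rule integral_cong_AE)
    have [measurable]: "\<phi> \<in> borel_measurable torus"
      using torus_smoothD(2)[OF \<phi>, of 0] by (auto intro!: borel_measurable_torus borel_measurable_continuous_onI)
    have [measurable]: "(\<lambda>x. g x $ i) \<in> borel_measurable torus" "(\<lambda>x. h x $ i) \<in> borel_measurable torus"
      using g \<open>integrable torus h\<close> by (auto intro!: borel_measurable_integrable integrable_vec_nth)
    show "(\<lambda>x. g x $ i * \<phi> x) \<in> borel_measurable torus" "(\<lambda>x. h x $ i * \<phi> x) \<in> borel_measurable torus"
      by measurable
    show "AE x in torus. g x $ i * \<phi> x = h x $ i * \<phi> x"
      using assms(4) by eventually_elim simp
  qed
  ultimately show ?thesis using assms(1,2) by (simp add: has_weak_gradient_def)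
qed

text \<open>Moves a translation from f to \<phi>, so that a weak derivative of the untranslated f
  can be tested against a translate of \<phi>.\<close>

lemma integral_torus_diff_mult:
  fixes f \<phi> :: "real ^ 'n \<Rightarrow> real"
  assumes "Zperiodic f" and [measurable]: "f \<in> borel_measurable borel" and B: "\<And>z. \<bar>f z\<bar> \<le> B"
    and \<phi>: "Zperiodic \<phi>" "continuous_on UNIV \<phi>"
  shows "(LINT x|torus. f (x - y) * \<phi> x) = (LINT x|torus. f x * \<phi> (x + y))"
proof -
  have [measurable]: "\<phi> \<in> borel_measurable borel" using \<phi> by (intro borel_measurable_continuous_onI)
  have per: "Zperiodic (\<lambda>x. f (x - y) * \<phi> x)"
    using assms(1) \<phi>(1) by (simp add: Zperiodic_def diff_add_eq[symmetric])
  have "(\<lambda>x. f (x - y)) \<in> borel_measurable torus" by measurable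
  then have "integrable torus (\<lambda>x. \<phi> x * f (x - y))"
    by (rule integrable_torus_mult_bounded[OF integrable_torus_continuous[OF \<phi>(2)]]) (rule B)
  then have "(LINT x|torus. f ((x + y) - y) * \<phi> (x + y)) = (LINT x|torus. f (x - y) * \<phi> x)"
    by (intro integral_torus_shift per) (simp_all add: mult.commute)
  then show ?thesis by simp
qed

text \<open>A translate of a test function is a test function. For each fixed y the defining
  identity of \<open>DW\<close> therefore holds for the translate of W by y; integrating it against
  r and exchanging the integrals gives the claim.\<close>

lemma has_weak_gradient_torus_conv:
  fixes W r :: "real ^ 'n \<Rightarrow> real" and DW :: "real ^ 'n \<Rightarrow> real ^ 'n"
  assumes wg: "has_weak_gradient W DW"
    and W: "\<And>z. \<bar>W z\<bar> \<le> B" and DW: "\<And>z. norm (DW z) \<le> C"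
    and r: "continuous_on UNIV r"
  shows "has_weak_gradient (torus_conv W r) (\<lambda>x. \<chi> i. torus_conv (\<lambda>z. DW z $ i) r x)"
proof -
  have per: "Zperiodic W" "Zperiodic DW" and int: "integrable torus W" "integrable torus DW"
    using wg by (auto simp: has_weak_gradient_def)
  let ?D = "\<lambda>i z. DW z $ i"
  have perD: "Zperiodic (?D i)" for i using per(2) by (simp add: Zperiodic_def)
  have Wm: "W \<in> borel_measurable borel"
    by (intro Zperiodic_borel_measurable per borel_measurable_integrable int)
  have Dm: "?D i \<in> borel_measurable borel" for i
    by (intro Zperiodic_borel_measurable perD borel_measurable_integrable integrable_vec_nth int)
  have Db: "\<bar>?D i z\<bar> \<le> C" for i z
    using component_le_norm_cart[of "DW z" i] DW[of z] by linarith
  have ri: "integrable torus r" by (rule integrable_torus_continuous[OF r])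
  have conv_int: "integrable torus (torus_conv f r)"
    if "f \<in> borel_measurable borel" "\<And>z. \<bar>f z\<bar> \<le> K" for f K
  proof (rule integrable_torus_bounded)
    show "torus_conv f r \<in> borel_measurable torus"
      by (rule borel_measurable_torus[OF borel_measurable_torus_conv[OF that(1) borel_measurable_integrable[OF ri]]])
    show "AE x in torus. norm (torus_conv f r x) \<le> K * (LINT y|torus. \<bar>r y\<bar>)"
      using torus_conv_bounded[OF that ri] by simp
  qed
  have "integrable torus (\<lambda>x. \<Sum>i\<in>UNIV. torus_conv (?D i) r x *\<^sub>R (axis i 1 :: real ^ 'n))"
    by (intro Bochner_Integration.integrable_sum integrable_scaleR_left conv_int[OF Dm Db])
  moreover have "(\<Sum>i\<in>UNIV. torus_conv (?D i) r x *\<^sub>R axis i 1) = (\<chi> i. torus_conv (?D i) r x)" for x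
    using basis_expansion[of "\<chi> i. torus_conv (?D i) r x"] by (simp add: scalar_mult_eq_scaleR)
  ultimately have "integrable torus (\<lambda>x. \<chi> i. torus_conv (?D i) r x)" by (simp only:)
  moreover have "Zperiodic (\<lambda>x. \<chi> i. torus_conv (?D i) r x)"
    using Zperiodic_torus_conv[OF perD, of _ r] by (simp add: Zperiodic_def)
  moreover have "(LINT x|torus. torus_conv W r x * partial_deriv i \<phi> x)
      = - (LINT x|torus. torus_conv (?D i) r x * \<phi> x)" if \<phi>: "\<phi> \<in> torus_smooth" for \<phi> i
  proof -
    have \<phi>c: "continuous_on UNIV \<phi>" "continuous_on UNIV (partial_deriv i \<phi>)"
      using torus_smoothD(2)[OF \<phi>, of 0] torus_smoothD(2)[OF \<phi>, of 1] by auto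
    have \<phi>p: "Zperiodic \<phi>" by (rule torus_smoothD(1)[OF \<phi>])
    have "(LINT x|torus. W (x - y) * partial_deriv i \<phi> x) = - (LINT x|torus. ?D i (x - y) * \<phi> x)" for y
    proof -
      have "(LINT x|torus. W (x - y) * partial_deriv i \<phi> x) = (LINT x|torus. W x * partial_deriv i \<phi> (x + y))"
        by (intro integral_torus_diff_mult[OF per(1) Wm W] Zperiodic_partial_deriv \<phi>c \<phi>p)
      also have "\<dots> = (LINT x|torus. W x * partial_deriv i (\<lambda>z. \<phi> (z + y)) x)"
        by (simp add: partial_deriv_shift)
      also have "\<dots> = - (LINT x|torus. ?D i x * \<phi> (x + y))"
        using wg torus_smooth_shift[OF \<phi>] by (simp add: has_weak_gradient_def)
      also have "(LINT x|torus. ?D i x * \<phi> (x + y)) = (LINT x|torus. ?D i (x - y) * \<phi> x)"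
        by (rule integral_torus_diff_mult[OF perD Dm Db \<phi>p \<phi>c(1), symmetric])
      finally show ?thesis .
    qed
    then show ?thesis
      by (simp add: torus_conv_Fubini[OF Wm W r \<phi>c(2)] torus_conv_Fubini[OF Dm Db r \<phi>c(1)])
  qed
  ultimately show ?thesis
    using conv_int[OF Wm W] Zperiodic_torus_conv[OF per(1)] by (simp add: has_weak_gradient_def)
qed

text \<open>The vector is written as one vector-valued integral, so that the norm goes inside at
  once. Estimating component by component would bring in a factor depending on the
  dimension.\<close>

lemma norm_torus_conv_vec_le:
  fixes r :: "real ^ 'n \<Rightarrow> real" and D :: "real ^ 'n \<Rightarrow> real ^ 'n"
  assumes [measurable]: "D \<in> borel_measurable borel" and D: "\<And>z. norm (D z) \<le> C"
    and r: "integrable torus r"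
  shows "norm (\<chi> i. torus_conv (\<lambda>z. D z $ i) r x) \<le> C * (LINT y|torus. \<bar>r y\<bar>)"
proof -
  have [measurable]: "r \<in> borel_measurable torus" using r by auto
  have m: "(\<lambda>y. r y *\<^sub>R D (x - y)) \<in> borel_measurable torus" by measurable
  have le: "norm (r y *\<^sub>R D (x - y)) \<le> C * \<bar>r y\<bar>" for y
    using mult_left_mono[OF D, of "\<bar>r y\<bar>" "x - y"] by (simp add: mult.commute)
  have i: "integrable torus (\<lambda>y. r y *\<^sub>R D (x - y))"
  proof (rule Bochner_Integration.integrable_bound[OF _ m])
    show "integrable torus (\<lambda>y. C * \<bar>r y\<bar>)" using r by simp
    show "AE y in torus. norm (r y *\<^sub>R D (x - y)) \<le> norm (C * \<bar>r y\<bar>)"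
      by (intro AE_I2 order_trans[OF le]) simp
  qed
  have "(\<chi> i. torus_conv (\<lambda>z. D z $ i) r x) = (LINT y|torus. r y *\<^sub>R D (x - y))"
    unfolding vec_eq_iff torus_conv_def
    using integral_bounded_linear[OF bounded_linear_vec_nth i] by (simp add: mult.commute)
  also have "norm \<dots> \<le> (LINT y|torus. norm (r y *\<^sub>R D (x - y)))"
    by (rule integral_norm_bound)
  also have "\<dots> \<le> (LINT y|torus. C * \<bar>r y\<bar>)"
    by (intro integral_mono integrable_norm i le) (use r in simp)
  finally show ?thesis by simp
qed

section \<open>Essential bounds and bounded representatives\<close>

lemma AE_Linf_norm_le:
  assumes "Linf_norm f \<le> ereal C"
  shows "AE x in torus. norm (f x) \<le> C"
proof -
  have "AE x in torus. ereal (norm (f x)) \<le> Linf_norm f"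
    unfolding Linf_norm_def by (rule esssup_AE)
  then show ?thesis
  proof eventually_elim
    case (elim x)
    then have "ereal (norm (f x)) \<le> ereal C" using assms by (rule order_trans)
    then show ?case by simp
  qed
qed

lemma Linf_norm_le:
  assumes [measurable]: "f \<in> borel_measurable torus" and "AE x in torus. norm (f x) \<le> C"
  shows "Linf_norm f \<le> ereal C"
  unfolding Linf_norm_def
proof (rule esssup_I)
  show "(\<lambda>x. ereal (norm (f x))) \<in> borel_measurable torus" by measurable
  show "AE x in torus. ereal (norm (f x)) \<le> ereal C" using assms(2) by simp
qed

lemma Linf_norm_nonneg: "0 \<le> Linf_norm f"
proof -
  have "AE x in torus. ereal (norm (f x)) \<le> Linf_norm f"
    unfolding Linf_norm_def by (rule esssup_AE)
  then have "AE x in (torus :: (real ^ 'a) measure). 0 \<le> Linf_norm f"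
  proof eventually_elim
    case (elim x)
    have "0 \<le> ereal (norm (f x))" by simp
    then show ?case using elim by (rule order_trans)
  qed
  then show ?thesis unfolding AE_torus_const .
qed

text \<open>Putting 0 wherever the bound fails changes \<open>DW\<close> only on a null set, and 0
  satisfies the bound because C is nonnegative. The convolution estimates require a bound at every
  point and Borel measurability on the whole space.\<close>

lemma bounded_weak_gradient:
  assumes wg: "has_weak_gradient W DW" and C: "Linf_norm DW \<le> ereal C"
  obtains D where "has_weak_gradient W D" "D \<in> borel_measurable borel" "\<And>z. norm (D z) \<le> C"
proof -
  have "0 \<le> ereal C" using Linf_norm_nonneg C by (rule order_trans)
  then have "0 \<le> C" by simp
  define D where "D z = (if norm (DW z) \<le> C then DW z else 0)" for z
  have [measurable]: "DW \<in> borel_measurable torus" using wg by (auto simp: has_weak_gradient_def)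
  have D: "D \<in> borel_measurable torus" unfolding D_def by measurable
  have per: "Zperiodic D" using wg by (simp add: has_weak_gradient_def Zperiodic_def D_def)
  have "AE z in torus. DW z = D z"
    using AE_Linf_norm_le[OF C] by eventually_elim (simp add: D_def)
  then have "has_weak_gradient W D" by (rule has_weak_gradient_cong_AE[OF wg per D])
  then show ?thesis
    by (rule that) (use Zperiodic_borel_measurable[OF per D] \<open>0 \<le> C\<close> in \<open>auto simp: D_def\<close>)
qed

lemma weak_gradient_torus_conv_bound:
  fixes W r :: "real ^ 'n \<Rightarrow> real"
  assumes wg: "has_weak_gradient W DW" and C: "Linf_norm DW \<le> ereal C"
    and W: "\<And>z. \<bar>W z\<bar> \<le> B" and r: "continuous_on UNIV r" and "0 \<le> b"
  obtains D where "has_weak_gradient (\<lambda>x. a + b * torus_conv W r x) D"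
    "\<And>x. norm (D x) \<le> b * (C * (LINT y|torus. \<bar>r y\<bar>))"
proof -
  obtain D where D: "has_weak_gradient W D" "D \<in> borel_measurable borel" "\<And>z. norm (D z) \<le> C"
    using bounded_weak_gradient[OF wg C] by blast
  have "has_weak_gradient (\<lambda>x. a + b * torus_conv W r x)
      (\<lambda>x. b *\<^sub>R (\<chi> i. torus_conv (\<lambda>z. D z $ i) r x))"
    by (intro has_weak_gradient_affine has_weak_gradient_torus_conv[OF D(1) W D(3) r])
  then show ?thesis
    using mult_left_mono[OF norm_torus_conv_vec_le[OF D(2,3) integrable_torus_continuous[OF r]] \<open>0 \<le> b\<close>]
    by (intro that) (auto simp: \<open>0 \<le> b\<close>)
qed

section \<open>Mean and oscillation of a convolution\<close>

lemma integral_torus_conv: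
  fixes W r :: "real ^ 'n \<Rightarrow> real"
  assumes "Zperiodic W" "W \<in> borel_measurable borel" "\<And>z. \<bar>W z\<bar> \<le> B" "continuous_on UNIV r"
  shows "(LINT x|torus. torus_conv W r x) = (LINT x|torus. W x) * (LINT x|torus. r x)"
proof -
  have one: "Zperiodic (\<lambda>x :: real ^ 'n. 1 :: real)" "continuous_on UNIV (\<lambda>x :: real ^ 'n. 1 :: real)"
    by (auto simp: Zperiodic_def)
  have "(LINT x|torus. W (x - y)) = (LINT x|torus. W x)" for y
    using integral_torus_diff_mult[OF assms(1-3) one] by simp
  then show ?thesis
    using torus_conv_Fubini[OF assms(2-4) one(2)] by (simp add: mult.commute)
qed

text \<open>Both convolutions are taken against the same nonnegative r, so the pointwise bound on
  differences of W integrates directly.\<close>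

lemma torus_conv_diff_le_osc:
  fixes W r :: "real ^ 'n \<Rightarrow> real"
  assumes W: "W \<in> borel_measurable borel" "\<And>z. \<bar>W z\<bar> \<le> B"
    and r: "integrable torus r" "\<And>y. 0 \<le> r y"
  shows "torus_conv W r x - torus_conv W r y \<le> torus_osc W * (LINT z|torus. r z)"
proof -
  have "bdd_above (range W)" "bdd_below (range W)"
    using W(2) by (auto intro!: bdd_aboveI2[of _ _ B] bdd_belowI2[of _ "- B"] simp: abs_le_iff minus_le_iff)
  then have osc: "W p - W q \<le> torus_osc W" for p q
    unfolding torus_osc_def by (intro diff_mono cSUP_upper cINF_lower) auto
  note i = integrable_torus_conv[OF W r(1)]
  have "torus_conv W r x - torus_conv W r y = (LINT z|torus. W (x - z) * r z - W (y - z) * r z)"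
    unfolding torus_conv_def by (intro Bochner_Integration.integral_diff[symmetric] i)
  also have "\<dots> \<le> (LINT z|torus. torus_osc W * r z)"
    by (intro integral_mono Bochner_Integration.integrable_diff i)
       (use r in \<open>auto simp: mult_right_mono[OF osc] simp flip: left_diff_distrib\<close>)
  finally show ?thesis by simp
qed

section \<open>The stationary density: continuous version, regularity, bounds and multiplier\<close>

theorem proposition4:
  fixes W \<rho> :: "real ^ 'n \<Rightarrow> real" and G :: "real \<Rightarrow> real" and \<beta> M \<rho>\<^sub>0 :: real
  assumes "\<beta> > 0" and "M > 0"
    and "\<And>s. G s = exp (- \<beta> * s)"
    and "admissible_kernel W"
    and "positive_stationary G W \<rho>"
    and "(LINT x|torus. \<rho> x) = M"
    and "\<rho>\<^sub>0 = M / measure (torus :: (real ^ 'n) measure) (space torus)"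
  shows "\<exists>r. positive_cont_version \<rho> r \<and>
    (\<forall>k. W \<in> torus_C k \<longrightarrow> r \<in> torus_C k) \<and>
    (W \<in> torus_W1inf \<longrightarrow>
       (\<lambda>x. ln (r x)) \<in> torus_W1inf \<and>
       (\<forall>DW Dr. has_weak_gradient W DW \<longrightarrow> has_weak_gradient (\<lambda>x. ln (r x)) Dr \<longrightarrow>
          Linf_norm Dr \<le> ereal (2 * \<beta> * M) * Linf_norm DW)) \<and>
    (SUP x. r x) / (INF x. r x) \<le> exp (2 * \<beta> * M * torus_osc W) \<and>
    (\<exists>!l. is_multiplier \<beta> W \<rho> l) \<and>
    (\<forall>l. is_multiplier \<beta> W \<rho> l \<longrightarrow>
       l \<le> ln \<rho>\<^sub>0 - 2 * \<beta> * \<rho>\<^sub>0 \<and>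
       (l = ln \<rho>\<^sub>0 - 2 * \<beta> * \<rho>\<^sub>0 \<longleftrightarrow> (\<forall>x. r x = \<rho>\<^sub>0)))"
proof -
  interpret prob_space "torus :: (real ^ 'n) measure" by (rule prob_space_torus)
  have \<rho>\<^sub>0: "\<rho>\<^sub>0 = M" using assms(7) by (simp add: prob_space)
  have Wp: "Zperiodic W" and "bounded (range W)" and W1: "(LINT x|torus. W x) = 1"
    using \<open>admissible_kernel W\<close> unfolding admissible_kernel_def by blast+
  then obtain B where B: "\<And>z. \<bar>W z\<bar> \<le> B" by (auto simp: bounded_iff)
  have Wm: "W \<in> borel_measurable borel"
    using \<open>admissible_kernel W\<close> by (rule borel_measurable_admissible_kernel)
  have \<rho>i: "integrable torus \<rho>" and \<rho>pos: "AE x in torus. 0 < \<rho> x"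
    and harm: "weakly_harmonic (\<lambda>x. (G (torus_conv W \<rho> x))\<^sup>2 * \<rho> x)"
    using assms(5) unfolding positive_stationary_def by blast+
  define u where "u = torus_conv W \<rho>"
  have uc: "continuous_on UNIV u"
    unfolding u_def
    by (rule continuous_torus_conv[OF Wm B \<rho>i negligible_admissible_kernel_discont[OF assms(4)]])
  have up: "Zperiodic u" unfolding u_def by (rule Zperiodic_torus_conv[OF Wp])
  \<comment> \<open>By weak harmonicity, \<open>(G (u x))\<^sup>2 * \<rho> x\<close> equals its mean
    almost everywhere; solving for \<rho> turns this mean into the prefactor of the
    exponential.\<close>
  define c where "c = (LINT x|torus. (G (u x))\<^sup>2 * \<rho> x)"
  have "(G t)\<^sup>2 = exp (- (2 * \<beta> * t))" for t
    by (simp add: assms(3) flip: exp_double)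
  then have "AE x in torus. exp (- (2 * \<beta> * u x)) * \<rho> x = c"
    using weakly_harmonic_AE_const[OF harm] by (simp add: u_def c_def)
  then have \<rho>eq: "AE x in torus. \<rho> x = c * exp (2 * \<beta> * u x)"
    by eventually_elim (auto simp: exp_minus field_simps)
  have "AE x in (torus :: (real ^ 'n) measure). 0 < c"
    using \<rho>eq \<rho>pos by eventually_elim (simp add: zero_less_mult_iff)
  then have "c > 0" by (simp only: AE_torus_const)
  define r where "r x = c * exp (2 * \<beta> * u x)" for x
  have rc: "continuous_on UNIV r" unfolding r_def by (intro continuous_intros uc)
  have rp: "Zperiodic r" using up by (simp add: Zperiodic_def r_def)
  have rpos: "0 < r x" for x using \<open>c > 0\<close> by (simp add: r_def)
  have ri: "integrable torus r" by (rule integrable_torus_continuous[OF rc])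
  have AEr: "AE x in torus. \<rho> x = r x" using \<rho>eq by (simp add: r_def)
  \<comment> \<open>This closes the loop: r now satisfies its fixed-point equation at every
    point.\<close>
  have ur: "u = torus_conv W r"
    unfolding u_def by (rule torus_conv_cong_AE[OF Wm _ _ AEr]) (use \<rho>i ri in auto)
  have rM: "(LINT x|torus. r x) = M"
    using integral_cong_AE[OF _ _ AEr] \<rho>i ri assms(6) by auto
  have uM: "(LINT x|torus. u x) = M"
    unfolding ur using integral_torus_conv[OF Wp Wm B rc] by (simp add: W1 rM)
  have lnr: "(\<lambda>x. ln (r x)) = (\<lambda>x. ln c + 2 * \<beta> * u x)"
    using \<open>c > 0\<close> by (simp add: r_def ln_mult)
  have version: "positive_cont_version \<rho> r"
    using rp rc rpos AEr by (simp add: positive_cont_version_def torus_C_def)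
  have reg: "r \<in> torus_C k" if "W \<in> torus_C k" for k
  proof -
    have "cont_diff k u"
      unfolding ur using that rc by (intro cont_diff_torus_conv) (auto simp: torus_C_def)
    then have "cont_diff k r"
      unfolding r_def by (intro cont_diff_mult cont_diff_const cont_diff_exp)
    then show ?thesis using rp by (simp add: torus_C_def)
  qed
  have grad: "\<exists>D. has_weak_gradient (\<lambda>x. ln (r x)) D \<and> (\<forall>x. norm (D x) \<le> 2 * \<beta> * M * C)"
    if "has_weak_gradient W DW" "Linf_norm DW \<le> ereal C" for DW C
  proof -
    have "(LINT y|torus. \<bar>r y\<bar>) = M" using rM rpos by (simp add: abs_of_pos)
    then show ?thesis
      using weak_gradient_torus_conv_bound[OF that B rc, of "2 * \<beta>" "ln c"] \<open>\<beta> > 0\<close>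
      unfolding lnr ur by (auto simp: mult_ac)
  qed
  have bound: "Linf_norm Dr \<le> ereal (2 * \<beta> * M) * Linf_norm DW"
    if DW: "has_weak_gradient W DW" and Dr: "has_weak_gradient (\<lambda>x. ln (r x)) Dr" for DW Dr
  proof (cases "Linf_norm DW")
    case (real C)
    then obtain D where D: "has_weak_gradient (\<lambda>x. ln (r x)) D" "\<And>x. norm (D x) \<le> 2 * \<beta> * M * C"
      using grad[OF DW, of C] by auto
    have "AE x in torus. norm (Dr x) \<le> 2 * \<beta> * M * C"
      using weak_gradient_unique[OF Dr D(1)] by eventually_elim (simp add: D(2))
    then have "Linf_norm Dr \<le> ereal (2 * \<beta> * M * C)"
      using Dr by (intro Linf_norm_le) (auto simp: has_weak_gradient_def)
    then show ?thesis by (simp add: real)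
  next
    \<comment> \<open>The right side is infinite because \<open>2 * \<beta> * M\<close> is
      positive.\<close>
    case PInf
    then show ?thesis using \<open>\<beta> > 0\<close> \<open>M > 0\<close> by simp
  next
    case MInf
    then show ?thesis using Linf_norm_nonneg[of DW] by simp
  qed
  have W1inf: "(\<lambda>x. ln (r x)) \<in> torus_W1inf" if W: "W \<in> torus_W1inf"
  proof -
    obtain DW where DW: "has_weak_gradient W DW" "Linf_norm DW < \<infinity>"
      using W by (auto simp: torus_W1inf_def)
    then obtain C where "Linf_norm DW \<le> ereal C"
      using Linf_norm_nonneg[of DW] by (cases "Linf_norm DW") auto
    then obtain D where D: "has_weak_gradient (\<lambda>x. ln (r x)) D" "\<And>x. norm (D x) \<le> 2 * \<beta> * M * C"
      using grad[OF DW(1)] by blast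
    have "Linf_norm D \<le> ereal (2 * \<beta> * M * C)"
      using D by (intro Linf_norm_le) (auto simp: has_weak_gradient_def)
    then have "Linf_norm D < \<infinity>" by auto
    moreover have lc: "continuous_on UNIV (\<lambda>x. ln (r x))" unfolding lnr by (intro continuous_intros uc)
    obtain K where "\<And>x. \<bar>ln (r x)\<bar> \<le> K"
      using bounded_Zperiodic_continuous[OF _ lc] rp by (auto simp: Zperiodic_def)
    then have "Linf_norm (\<lambda>x. ln (r x)) \<le> ereal K"
      by (intro Linf_norm_le borel_measurable_torus borel_measurable_continuous_onI lc) auto
    then have "Linf_norm (\<lambda>x. ln (r x)) < \<infinity>" by auto
    ultimately show ?thesis using D(1) by (auto simp: torus_W1inf_def)
  qed
  have harnack: "(SUP x. r x) / (INF x. r x) \<le> exp (2 * \<beta> * M * torus_osc W)" (is "_ \<le> ?K")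
  proof -
    have "r x \<le> ?K * r y" for x y
    proof -
      have "u x - u y \<le> torus_osc W * M"
        using torus_conv_diff_le_osc[OF Wm B ri] rpos by (simp add: ur rM less_imp_le)
      then have "2 * \<beta> * (u x - u y) \<le> 2 * \<beta> * (torus_osc W * M)"
        using \<open>\<beta> > 0\<close> by (intro mult_left_mono) auto
      then have "exp (2 * \<beta> * u x) \<le> exp (2 * \<beta> * M * torus_osc W + 2 * \<beta> * u y)"
        by (simp add: algebra_simps)
      then show ?thesis using \<open>c > 0\<close> by (simp add: r_def exp_add mult_ac)
    qed
    then have "(SUP x. r x) \<le> ?K * r y" for y by (intro cSUP_least) auto
    then have "(SUP x. r x) / ?K \<le> r y" for y by (simp add: divide_le_eq mult.commute)
    then have le: "(SUP x. r x) / ?K \<le> (INF y. r y)" by (intro cINF_greatest) auto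
    obtain R where "\<And>x. \<bar>r x\<bar> \<le> R" using bounded_Zperiodic_continuous[OF rp rc] by blast
    then have "bdd_above (range r)" by (auto intro!: bdd_aboveI2[of _ _ R] simp: abs_le_iff)
    then have "r 0 \<le> (SUP x. r x)" by (rule cSUP_upper[rotated]) simp
    then have "0 < (SUP x. r x) / ?K" using rpos[of 0] by simp
    \<comment> \<open>Positivity of the infimum follows from the comparison itself and is what
      permits dividing by it.\<close>
    then have "0 < (INF y. r y)" using le by linarith
    then show ?thesis using le by (simp add: divide_le_eq mult.commute)
  qed
  have mult_iff: "is_multiplier \<beta> W \<rho> l \<longleftrightarrow> l = ln c" for l
  proof -
    have eq: "AE x in torus. ln (\<rho> x) - 2 * \<beta> * torus_conv W \<rho> x = ln c"
      using AEr by eventually_elim (simp add: fun_cong[OF lnr] flip: u_def)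
    show ?thesis
    proof
      assume "is_multiplier \<beta> W \<rho> l"
      then have "AE x in (torus :: (real ^ 'n) measure). l = ln c"
        using eq unfolding is_multiplier_def by eventually_elim simp
      then show "l = ln c" by (simp only: AE_torus_const)
    qed (use eq in \<open>simp add: is_multiplier_def\<close>)
  qed
  text \<open>Jensen's inequality for the exponential, through the gap to its tangent at the mean.\<close>
  define gap where "gap x = r x - c * exp (2 * \<beta> * M) * (1 + 2 * \<beta> * u x - 2 * \<beta> * M)" for x
  have gap: "gap x = c * exp (2 * \<beta> * M) * (exp (2 * \<beta> * u x - 2 * \<beta> * M) - (1 + (2 * \<beta> * u x - 2 * \<beta> * M)))" for x
    by (simp add: gap_def r_def exp_diff algebra_simps)
  have gap_nonneg: "0 \<le> gap x" for x
    unfolding gap using \<open>c > 0\<close> exp_ge_add_one_self[of "2 * \<beta> * u x - 2 * \<beta> * M"]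
    by (intro mult_nonneg_nonneg) auto
  have gapc: "continuous_on UNIV gap" unfolding gap_def by (intro continuous_intros rc uc)
  \<comment> \<open>The linear part of the tangent integrates to 0 because \<open>u\<close> has mean
    M, leaving the mass minus the value of the exponential at the mean.\<close>
  have gap_int: "(LINT x|torus. gap x) = M - c * exp (2 * \<beta> * M)"
    unfolding gap_def using ri integrable_torus_continuous[OF uc] by (simp add: rM uM prob_space)
  have "0 \<le> (LINT x|torus. gap x)" using gap_nonneg by (rule Bochner_Integration.integral_nonneg)
  then have "ln (c * exp (2 * \<beta> * M)) \<le> ln M"
    using \<open>c > 0\<close> \<open>M > 0\<close> by (simp add: gap_int)
  then have ineq: "ln c \<le> ln M - 2 * \<beta> * M" using \<open>c > 0\<close> by (simp add: ln_mult)
  have equality: "ln c = ln M - 2 * \<beta> * M \<longleftrightarrow> (\<forall>x. r x = M)"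
  proof
    assume "ln c = ln M - 2 * \<beta> * M"
    then have "ln (c * exp (2 * \<beta> * M)) = ln M" using \<open>c > 0\<close> by (simp add: ln_mult)
    then have cM: "c * exp (2 * \<beta> * M) = M" using \<open>c > 0\<close> \<open>M > 0\<close> by simp
    then have "AE x in torus. gap x = 0"
      using gap_int gap_nonneg integral_nonneg_eq_0_iff_AE[OF integrable_torus_continuous[OF gapc]] by simp
    then have "gap x = 0" for x
      using up rp by (intro Zperiodic_continuous_AE_imp_eq[OF _ gapc]) (auto simp: Zperiodic_def gap_def)
    then have "exp (2 * \<beta> * u x - 2 * \<beta> * M) - 1 = 2 * \<beta> * u x - 2 * \<beta> * M" for x
      using \<open>c > 0\<close> by (simp add: gap)
    \<comment> \<open>Strict convexity: the exponential touches its tangent at 0 only there, stated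
      through the equality case of ln t \<le> t - 1.\<close>
    then have "exp (2 * \<beta> * u x - 2 * \<beta> * M) = 1" for x
      by (intro ln_eq_minus_one) auto
    then have "u x = M" for x using \<open>\<beta> > 0\<close> by simp
    then show "\<forall>x. r x = M" using cM by (simp add: r_def)
  next
    assume rconst: "\<forall>x. r x = M"
    then have "c * exp (2 * \<beta> * u x) = c * exp (2 * \<beta> * u 0)" for x by (simp add: r_def[symmetric])
    \<comment> \<open>A constant density gives a constant \<open>u\<close> by injectivity of the
      exponential; the mean of \<open>u\<close> then identifies the constant as M.\<close>
    then have "u x = u 0" for x using \<open>c > 0\<close> \<open>\<beta> > 0\<close> by simp
    then have "u = (\<lambda>_. u 0)" by blast
    then have "(LINT x|torus. u x) = (LINT x|(torus :: (real ^ 'n) measure). u 0)" by simp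
    then have "u 0 = M" using uM by (simp add: prob_space)
    then have "M = c * exp (2 * \<beta> * M)" using rconst[rule_format, of 0] by (simp add: r_def)
    then have "ln M = ln (c * exp (2 * \<beta> * M))" by (rule arg_cong)
    then show "ln c = ln M - 2 * \<beta> * M" using \<open>c > 0\<close> by (simp add: ln_mult)
  qed
  show ?thesis
    unfolding mult_iff \<rho>\<^sub>0 using version reg W1inf bound harnack ineq equality by (intro exI[of _ r]) simp
qed

end
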